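(* Let $\mathcal{X}^B$ be an irreducible, time-homogeneous, continuous-time Markov chain on $\{1,2,\dots,s\}$ ($s\ge 2$) with transition rate matrix $Q^B$. For every $\varepsilon'\in\{1,2\}$ and $j\in\{3,4,\dots,s\}$, the linear equation $$Q^B_0\,u(j)=-p^B_{jB\varepsilon'}\,\mathbf e^B_j$$ has a unique solution $u(j)=(u_1(j),\dots,u_s(j))^{\mathrm T}$, and $u(j)\in[0,\infty)^s$. The quantities $\mathrm E_{i\varepsilon'}[\chi^B_{\varepsilon'}(j)]$ (in particular those with $i=\varepsilon\in\{1,2\}$) can be computed from it as follows, for $i\in\{1,2,\dots,s\}$: if $u_i(j)=0$, then $\mathrm E_{i\varepsilon'}[\chi^B_{\varepsilon'}(j)]=0$; if $u_i(j)>0$, then $$\mathrm E_{i\varepsilon'}[\chi^B_{\varepsilon'}(j)]=\frac{u_i(j)}{p^B_{iB\varepsilon'}}.$$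
   Context: For $i\ne j$, $Q^B_{ij}\ge 0$ is the transition rate of $\mathcal{X}^B$ from $i$ to $j$, and $Q^B_{ii}=-\sum_{j\ne i}Q^B_{ij}$. Define the $s\times s$ matrix $$Q^B_0=\begin{bmatrix}Q^B_{11}&0&Q^B_{13}&\dots&Q^B_{1s}\\0&Q^B_{22}&Q^B_{23}&\dots&Q^B_{2s}\\0&0&Q^B_{33}&\dots&Q^B_{3s}\\\vdots&\vdots&\vdots&\ddots&\vdots\\0&0&Q^B_{s3}&\dots&Q^B_{ss}\end{bmatrix},$$ i.e. $Q^B$ with its first two columns replaced by $Q^B_{11}\mathbf e^B_1$ and $Q^B_{22}\mathbf e^B_2$, where $\mathbf e^B_j\in\mathbb R^s$ denotes the canonical $j$th unit vector. For $\varepsilon\in\{1,2\}$, $$\sigma^B_\varepsilon=\begin{cases}\inf\{t>0\,|\,\exists u\in(0,t):\ \mathcal{X}^B_u\ne\varepsilon,\ \mathcal{X}^B_t=\varepsilon\},&\text{if }\mathcal{X}^B_0=\varepsilon,\\ \inf\{t>0\,|\,\mathcal{X}^B_t=\varepsilon\},&\text{otherwise,}\end{cases}$$ and for $i\in\{1,2,\dots,s\}$, $\varepsilon'\in\{1,2\}$, $$p^B_{iB\varepsilon'}=\mathrm P(\sigma^B_{\varepsilon'}<\sigma^B_{3-\varepsilon'}\,|\,\mathcal{X}^B_0=i).$$ For $j\in\{3,\dots,s\}$, $\chi^B_{\varepsilon'}(j)=\int_0^{\sigma^B_{\varepsilon'}}\mathbf 1(\mathcal{X}^B_t=j)\,\mathrm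 dt$, and for $i\in\{1,\dots,s\}$, $$\mathrm E_{i\varepsilon'}[\chi^B_{\varepsilon'}(j)]=\frac{\mathrm E_i[\chi^B_{\varepsilon'}(j)\mathbf 1(\sigma^B_{\varepsilon'}<\sigma^B_{3-\varepsilon'})]}{\mathrm P_i(\sigma^B_{\varepsilon'}<\sigma^B_{3-\varepsilon'})}$$ if the denominator is nonzero, and $0$ otherwise; here $\mathrm P_i,\mathrm E_i$ are probability and expectation for the process started from $i$. *)

theory Defs
  imports "HOL-Probability.Probability" "Jordan_Normal_Form.Determinant"
begin

unbundle no vec_syntax
no_notation inner (infix "\<bullet>" 70)

(* The library indexes vectors and matrices from 0, whereas the states are 1, ..., s. *)
abbreviation mat_entry :: "real mat \<Rightarrow> nat \<Rightarrow> nat \<Rightarrow> real" where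
  "mat_entry A i j \<equiv> A $$ (i - 1, j - 1)"

abbreviation vec_entry :: "real vec \<Rightarrow> nat \<Rightarrow> real" where
  "vec_entry u i \<equiv> u $ (i - 1)"

abbreviation canonical_vec :: "nat \<Rightarrow> nat \<Rightarrow> real vec" where
  "canonical_vec s j \<equiv> unit_vec s (j - 1)"

(* The chain is given as a Markov family: one process X on one measurable space F, together
   with the laws P i of the process started from the state i.  Only times t \<ge> 0 matter.
   As is usual for continuous-time chains, paths are right-continuous (for the discrete
   topology on the states).  The Markov property is required conditionally on finitely many
   past observations; since the right-hand side P k (X h = l) does not depend on t, it
   includes time-homogeneity.  Transition rates are the right derivatives at 0 of the
   transition probabilities. *)
locale markov_chain =
  fixes s :: nat
    and Q :: "real mat"
    and F :: "'w measure"
    and P :: "nat \<Rightarrow> 'w measure"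
    and X :: "real \<Rightarrow> 'w \<Rightarrow> nat"
  assumes rate_matrix_dim: "Q \<in> carrier_mat s s"
    and rate_nonneg: "\<And>i j. i \<in> {1..s} \<Longrightarrow> j \<in> {1..s} \<Longrightarrow> i \<noteq> j \<Longrightarrow> 0 \<le> mat_entry Q i j"
    and rate_diag: "\<And>i. i \<in> {1..s} \<Longrightarrow>
      mat_entry Q i i = - (\<Sum>j\<in>{1..s} - {i}. mat_entry Q i j)"
    and law_prob_space: "\<And>i. i \<in> {1..s} \<Longrightarrow> prob_space (P i)"
    and law_sets: "\<And>i. i \<in> {1..s} \<Longrightarrow> sets (P i) = sets F"
    and state_measurable: "\<And>t. 0 \<le> t \<Longrightarrow> X t \<in> measurable F (count_space {1..s})"
    and start: "\<And>i. i \<in> {1..s} \<Longrightarrow> AE \<omega> in P i. X 0 \<omega> = i"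
    and right_continuous: "\<And>\<omega> t. \<omega> \<in> space F \<Longrightarrow> 0 \<le> t \<Longrightarrow>
      continuous (at_right t) (\<lambda>u. X u \<omega>)"
    and markov_property: "\<And>i k l t h U x.
      i \<in> {1..s} \<Longrightarrow> k \<in> {1..s} \<Longrightarrow> l \<in> {1..s} \<Longrightarrow> 0 \<le> t \<Longrightarrow> 0 \<le> h \<Longrightarrow>
      finite U \<Longrightarrow> U \<subseteq> {0..t} \<Longrightarrow>
      \<P>(\<omega> in P i. X t \<omega> = k \<and> (\<forall>u\<in>U. X u \<omega> = x u)) \<noteq> 0 \<Longrightarrow>
      \<P>(\<omega> in P i. X (t + h) \<omega> = l \<bar> X t \<omega> = k \<and> (\<forall>u\<in>U. X u \<omega> = x u))
        = \<P>(\<omega> in P k. X h \<omega> = l)"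
    and transition_rate: "\<And>i j. i \<in> {1..s} \<Longrightarrow> j \<in> {1..s} \<Longrightarrow> i \<noteq> j \<Longrightarrow>
      ((\<lambda>h. \<P>(\<omega> in P i. X h \<omega> = j) / h) \<longlongrightarrow> mat_entry Q i j) (at_right 0)"

definition irreducible_chain ::
    "nat \<Rightarrow> (nat \<Rightarrow> 'w measure) \<Rightarrow> (real \<Rightarrow> 'w \<Rightarrow> nat) \<Rightarrow> bool" where
  "irreducible_chain s P X \<longleftrightarrow>
    (\<forall>i\<in>{1..s}. \<forall>j\<in>{1..s}. \<exists>t\<ge>0. 0 < \<P>(\<omega> in P i. X t \<omega> = j))"

(* The columns of the states 1 and 2 (indices 0 and 1) keep only their diagonal entry. *)
definition Q0 :: "nat \<Rightarrow> real mat \<Rightarrow> real mat" where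
  "Q0 s Q = mat s s (\<lambda>(a, b). if b < 2 \<and> a \<noteq> b then 0 else Q $$ (a, b))"

(* Infima are taken in the extended reals, so that inf {} = \<infinity>. *)
definition sigma :: "(real \<Rightarrow> 'w \<Rightarrow> nat) \<Rightarrow> nat \<Rightarrow> 'w \<Rightarrow> ereal" where
  "sigma X \<epsilon> \<omega> =
    (if X 0 \<omega> = \<epsilon>
     then Inf (ereal ` {t. 0 < t \<and> (\<exists>u\<in>{0<..<t}. X u \<omega> \<noteq> \<epsilon>) \<and> X t \<omega> = \<epsilon>})
     else Inf (ereal ` {t. 0 < t \<and> X t \<omega> = \<epsilon>}))"

definition hit_prob ::
    "(nat \<Rightarrow> 'w measure) \<Rightarrow> (real \<Rightarrow> 'w \<Rightarrow> nat) \<Rightarrow> nat \<Rightarrow> nat \<Rightarrow> real" where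
  "hit_prob P X i \<epsilon> = \<P>(\<omega> in P i. sigma X \<epsilon> \<omega> < sigma X (3 - \<epsilon>) \<omega>)"

definition occupation ::
    "(real \<Rightarrow> 'w \<Rightarrow> nat) \<Rightarrow> nat \<Rightarrow> nat \<Rightarrow> 'w \<Rightarrow> ennreal" where
  "occupation X \<epsilon> j \<omega> =
    (\<integral>\<^sup>+t\<in>{t. 0 \<le> t \<and> ereal t \<le> sigma X \<epsilon> \<omega>}. indicator {t. X t \<omega> = j} t \<partial>lborel)"

definition cond_occupation ::
    "(nat \<Rightarrow> 'w measure) \<Rightarrow> (real \<Rightarrow> 'w \<Rightarrow> nat) \<Rightarrow> nat \<Rightarrow> nat \<Rightarrow> nat \<Rightarrow> ennreal" where
  "cond_occupation P X i \<epsilon> j =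
    (if hit_prob P X i \<epsilon> \<noteq> 0
     then (\<integral>\<^sup>+\<omega>\<in>{\<omega>. sigma X \<epsilon> \<omega> < sigma X (3 - \<epsilon>) \<omega>}. occupation X \<epsilon> j \<omega> \<partial>P i)
            / ennreal (hit_prob P X i \<epsilon>)
     else 0)"

definition is_solution ::
    "nat \<Rightarrow> real mat \<Rightarrow> (nat \<Rightarrow> 'w measure) \<Rightarrow> (real \<Rightarrow> 'w \<Rightarrow> nat) \<Rightarrow> nat \<Rightarrow> nat \<Rightarrow> real vec \<Rightarrow> bool"
  where
  "is_solution s Q P X \<epsilon> j u \<longleftrightarrow>
    u \<in> carrier_vec s \<and> Q0 s Q *\<^sub>v u = (- hit_prob P X j \<epsilon>) \<cdot>\<^sub>v canonical_vec s j"

end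

theory Submission
  imports Defs
begin

text \<open>
  Call a time \<open>v\<close> an entry into the state \<open>e\<close> if the path is at \<open>e\<close> at time \<open>v\<close> but was elsewhere at
  some earlier time. Both cases in the definition of the return or hitting time \<open>\<sigma>\<close> of \<open>e\<close> say the same:
  it is the infimum of the entries into \<open>e\<close>. So it is natural to kill the chain at its
  first entry into \<open>{1, 2}\<close>; a start in \<open>1\<close> or \<open>2\<close> is not an entry, and the chain can leave it for the
  states from \<open>3\<close> on without being killed. Its transition probabilities
  \<open>R\<^sub>t(i, k) = P\<^sub>i(no entry into {1, 2} up to t, X\<^sub>t = k)\<close> form a semigroup on all of \<open>{1, ..., s}\<close>. A jump into
  \<open>{1, 2}\<close> kills and no other jump does, so the generator is \<open>Q\<close> with the off-diagonal entries of the
  columns \<open>1\<close> and \<open>2\<close> deleted, which is the matrix \<open>Q\<^sub>0\<close> (\<open>killed_generator\<close>).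

  The Green function \<open>G(i, k)\<close>, the integral of \<open>R\<^sub>t(i, k)\<close> over all \<open>t\<close>, is finite: by irreducibility an entry
  occurs within some fixed time with a probability bounded away from \<open>0\<close>, uniformly in the starting state,
  so the survival probability decays geometrically. Cutting the integral at a small time \<open>h\<close> gives
  \<open>G = (integral of R over [0, h)) + R\<^sub>h G\<close>; dividing by \<open>h\<close> and letting \<open>h\<close> tend to \<open>0\<close> gives \<open>Q\<^sub>0 G = -1\<close>
  (\<open>green_right_inverse\<close>). Thus \<open>Q\<^sub>0\<close> is invertible with inverse \<open>-G\<close>, and the equation of the proposition has
  the unique solution \<open>u\<^sub>i = G(i, j) p\<^sub>j\<close>, which is nonnegative.

  It remains to recognise \<open>u\<^sub>i\<close>. If the path is at \<open>j\<close> at time \<open>t\<close>, with \<open>j\<close> neither \<open>1\<close> nor \<open>2\<close>, then the time \<open>t\<close>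
  counts for the occupation time on the event \<open>\<sigma>\<^sub>\<epsilon> < \<sigma>\<^sub>3\<^sub>-\<^sub>\<epsilon>\<close> exactly if there was no entry into \<open>{1, 2}\<close> up to \<open>t\<close> and
  the path shifted by \<open>t\<close> hits \<open>\<epsilon>\<close> first (\<open>enters_before_from\<close>). Fubini's theorem and the Markov
  property at the fixed time \<open>t\<close> turn the expected occupation time on this event into \<open>G(i, j) p\<^sub>j\<close>
  (\<open>occupation_eq_green\<close>).

  The generator is the delicate point, as the Markov property speaks about finitely many times while
  killing depends on the whole path. A right-continuous path with an entry before \<open>h\<close> shows a step into
  \<open>{1, 2}\<close> on every fine enough grid with the end point \<open>h\<close>. Hence a union bound over the steps of a grid,
  in the limit of fine grids, bounds the probability of an entry by \<open>h\<close> times the total rate from \<open>i\<close> into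
  \<open>{1, 2}\<close>, up to \<open>o(h)\<close> (\<open>entry_prob_bound\<close>). Up to \<open>o(h)\<close> this is also the probability that the
  chain is found in a state of \<open>{1, 2}\<close> other than \<open>i\<close> at time \<open>h\<close>, so an entry that is followed by
  another jump before \<open>h\<close> has probability \<open>o(h)\<close>.
\<close>

section \<open>Entries of a right-continuous path\<close>

text \<open>Right-continuity for the discrete topology on the states.\<close>

definition right_const :: "(real \<Rightarrow> 'a) \<Rightarrow> bool" where
  "right_const f \<longleftrightarrow> (\<forall>t\<ge>0. \<exists>d>0. \<forall>u. t \<le> u \<longrightarrow> u < t + d \<longrightarrow> f u = f t)"

definition entries :: "'a \<Rightarrow> (real \<Rightarrow> 'a) \<Rightarrow> real set" where
  "entries e f = {v. f v = e \<and> (\<exists>u. 0 \<le> u \<and> u < v \<and> f u \<noteq> e)}"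

definition avoids :: "'a set \<Rightarrow> (real \<Rightarrow> 'a) \<Rightarrow> real \<Rightarrow> bool" where
  "avoids K f t \<longleftrightarrow> (\<forall>e\<in>K. \<forall>v\<in>entries e f. t < v)"

text \<open>Only consecutive points of the grid \<open>0, t/n, ..., t\<close> are compared. This misses excursions between grid
  points, but it is an event that depends on finitely many times.\<close>

definition grid_avoids :: "'a set \<Rightarrow> (real \<Rightarrow> 'a) \<Rightarrow> real \<Rightarrow> nat \<Rightarrow> bool" where
  "grid_avoids K f t n \<longleftrightarrow>
    (\<forall>k<n. f (real (Suc k) * t / real n) \<in> K \<longrightarrow>
       f (real k * t / real n) = f (real (Suc k) * t / real n))"

lemma entries_pos: "v \<in> entries e f \<Longrightarrow> 0 < v"
  by (auto simp: entries_def)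

text \<open>A start at \<open>e\<close> forces the witness \<open>u\<close> of an entry to be positive, and a start elsewhere makes \<open>u = 0\<close> a
  witness for every visit to \<open>e\<close>. So one formula covers the return time and the hitting time.\<close>

lemma sigma_eq_Inf_entries: "sigma X e \<omega> = Inf (ereal ` entries e (\<lambda>t. X t \<omega>))"
proof (cases "X 0 \<omega> = e")
  case True
  have "{t. 0 < t \<and> (\<exists>u\<in>{0<..<t}. X u \<omega> \<noteq> e) \<and> X t \<omega> = e} = entries e (\<lambda>t. X t \<omega>)"
    using True by (force simp: entries_def less_le)
  then show ?thesis using True by (simp add: sigma_def)
next
  case False
  have "{t. 0 < t \<and> X t \<omega> = e} = entries e (\<lambda>t. X t \<omega>)"
    using False by (force simp: entries_def)
  then show ?thesis using False by (simp add: sigma_def)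
qed

lemma avoids_mono: "avoids K f t \<Longrightarrow> u \<le> t \<Longrightarrow> avoids K f u"
  by (force simp: avoids_def)

lemma avoids_constD: "avoids K f t \<Longrightarrow> 0 \<le> u \<Longrightarrow> u \<le> v \<Longrightarrow> v \<le> t \<Longrightarrow> f v \<in> K \<Longrightarrow> f u = f v"
  by (force simp: avoids_def entries_def less_le)

lemma avoids_iff:
  "avoids K f t \<longleftrightarrow> (\<forall>u v. 0 \<le> u \<longrightarrow> u \<le> v \<longrightarrow> v \<le> t \<longrightarrow> f v \<in> K \<longrightarrow> f u = f v)"
proof
  assume "avoids K f t"
  then show "\<forall>u v. 0 \<le> u \<longrightarrow> u \<le> v \<longrightarrow> v \<le> t \<longrightarrow> f v \<in> K \<longrightarrow> f u = f v"
    using avoids_constD[of K f t] by blast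
next
  assume R: "\<forall>u v. 0 \<le> u \<longrightarrow> u \<le> v \<longrightarrow> v \<le> t \<longrightarrow> f v \<in> K \<longrightarrow> f u = f v"
  show "avoids K f t"
    unfolding avoids_def
  proof (intro ballI)
    fix e v assume "e \<in> K" "v \<in> entries e f"
    then obtain u where "f v = e" "0 \<le> u" "u < v" "f u \<noteq> e" by (auto simp: entries_def)
    with R \<open>e \<in> K\<close> show "t < v" by (metis less_eq_real_def not_less)
  qed
qed

text \<open>The pathwise source of the semigroup property: the present state links the two halves, since an entry
  after \<open>t\<close> that differs from the path before \<open>t\<close> also differs from the path at \<open>t\<close>, unless the state at \<open>t\<close>
  was itself entered before.\<close>

lemma avoids_add:
  assumes "0 \<le> t" "0 \<le> r"
  shows "avoids K f (t + r) \<longleftrightarrow> avoids K f t \<and> avoids K (\<lambda>v. f (t + v)) r"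
proof (intro iffI conjI)
  assume L: "avoids K f (t + r)"
  show "avoids K f t" using L assms by (auto intro: avoids_mono)
  show "avoids K (\<lambda>v. f (t + v)) r"
    using L assms unfolding avoids_iff by auto
next
  assume R: "avoids K f t \<and> avoids K (\<lambda>v. f (t + v)) r"
  show "avoids K f (t + r)"
    unfolding avoids_iff
  proof (intro allI impI)
    fix u v :: real
    assume uv: "0 \<le> u" "u \<le> v" "v \<le> t + r" "f v \<in> K"
    have late: "f x = f v" if "t \<le> x" "x \<le> v" for x
      using avoids_constD[OF conjunct2[OF R], of "x - t" "v - t"] uv that by simp
    show "f u = f v"
    proof (cases "v \<le> t")
      case True
      then show ?thesis using avoids_constD[OF conjunct1[OF R]] uv by blast
    next
      case False
      then have "f t = f v" using uv by (intro late) auto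
      moreover have "f u = f t" if "u < t"
        by (rule avoids_constD[OF conjunct1[OF R]]) (use uv that \<open>f t = f v\<close> in auto)
      ultimately show ?thesis using late[of u] uv by (metis not_le)
    qed
  qed
qed

lemma avoids_imp_grid:
  assumes "avoids K f t" "0 \<le> t"
  shows "grid_avoids K f t n"
  unfolding grid_avoids_def
proof (intro allI impI)
  fix k assume k: "k < n" "f (real (Suc k) * t / real n) \<in> K"
  have le: "real (Suc k) * t / real n \<le> t"
    using k assms(2) by (simp add: pos_divide_le_eq mult.commute mult_left_mono del: of_nat_Suc)
  have "real k * t / real n \<le> real (Suc k) * t / real n"
    using assms(2) by (intro divide_right_mono mult_right_mono) auto
  then show "f (real k * t / real n) = f (real (Suc k) * t / real n)"
    by (intro avoids_constD[OF assms(1) _ _ le k(2)]) (use assms(2) in auto)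
qed

lemma first_step_into:
  assumes "(a::nat) < b" "g b = e" "g a \<noteq> e"
  shows "\<exists>k. a \<le> k \<and> k < b \<and> g k \<noteq> e \<and> g (Suc k) = e"
  using assms
proof (induction b)
  case (Suc b)
  then show ?case
    by (cases "g b = e") (metis less_Suc_eq, metis less_Suc_eq less_Suc_eq_le)
qed simp

text \<open>By right-continuity the two states that witness an entry persist for a short while, so a fine grid
  sees both of them, in the right order. Between these two grid points some step must then go into the
  entered state. The end point \<open>t\<close> lies on every grid, which takes care of an entry at \<open>t\<close> itself.\<close>

lemma grid_detects_entry:
  assumes f: "right_const f" and t: "0 \<le> t" and fail: "\<not> avoids K f t"
  shows "\<exists>m. \<forall>n\<ge>m. 0 < n \<longrightarrow> \<not> grid_avoids K f t n"
proof -
  from fail obtain u v where uv: "0 \<le> u" "u \<le> v" "v \<le> t" "f v \<in> K" "f u \<noteq> f v"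
    unfolding avoids_iff by blast
  then have "u < v" by (metis less_eq_real_def)
  with uv have "0 < t" "0 \<le> v" by auto
  obtain d1 where d1: "d1 > 0" "\<And>x. u \<le> x \<Longrightarrow> x < u + d1 \<Longrightarrow> f x = f u"
    using f uv unfolding right_const_def by meson
  obtain d2 where d2: "d2 > 0" "\<And>x. v \<le> x \<Longrightarrow> x < v + d2 \<Longrightarrow> f x = f v"
    using f \<open>0 \<le> v\<close> unfolding right_const_def by meson
  obtain m where m: "real m > t / min d1 d2"
    using reals_Archimedean2 by blast
  show ?thesis
  proof (intro exI[of _ m] allI impI notI)
    fix n assume n: "m \<le> n" "0 < n" and grid: "grid_avoids K f t n"
    have "t / min d1 d2 < real n" using m n by linarith
    then have "t / real n < min d1 d2"
      using d1(1) d2(1) n(2) by (metis mult.commute pos_divide_less_eq min_less_iff_conj of_nat_0_less_iff)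
    then have step: "t / real n < d1" "t / real n < d2" by simp_all
    \<comment> \<open>the first grid point at or after x\<close>
    define c where "c x = nat \<lceil>x * real n / t\<rceil>" for x
    have c: "x \<le> real (c x) * t / real n" "real (c x) * t / real n < x + t / real n" if "0 \<le> x" for x
    proof -
      have nn: "0 \<le> x * real n / t" using that \<open>0 < t\<close> by simp
      then have rc: "real (c x) = real_of_int \<lceil>x * real n / t\<rceil>"
        unfolding c_def by (intro of_nat_nat) linarith
      have "x * real n / t \<le> real (c x)" "real (c x) < x * real n / t + 1"
        unfolding rc by linarith+
      then show "x \<le> real (c x) * t / real n" "real (c x) * t / real n < x + t / real n"
        using \<open>0 < t\<close> n by (auto simp: field_simps)
    qed
    have fu: "f (real (c u) * t / real n) = f u"
      using c[of u] uv step by (intro d1(2)) auto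
    have fv: "f (real (c v) * t / real n) = f v"
      using c[of v] uv step by (intro d2(2)) auto
    have "v * real n / t \<le> real n" using uv \<open>0 < t\<close> by (simp add: pos_divide_le_eq mult.commute mult_right_mono)
    then have "c v \<le> n" unfolding c_def by linarith
    have "c u \<le> c v" unfolding c_def
      using uv \<open>0 < t\<close> by (intro nat_mono ceiling_mono divide_right_mono mult_right_mono) auto
    moreover have "c u \<noteq> c v" using fu fv uv by metis
    ultimately have "c u < c v" by simp
    from first_step_into[of "c u" "c v" "\<lambda>k. f (real k * t / real n)" "f v"] this fu fv uv
    obtain k where "k < c v" "f (real k * t / real n) \<noteq> f v" "f (real (Suc k) * t / real n) = f v"
      by auto
    with grid \<open>c v \<le> n\<close> uv show False
      unfolding grid_avoids_def by (metis order_less_le_trans)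
  qed
qed

lemma avoids_iff_grid:
  assumes "right_const f" "0 \<le> t"
  shows "avoids K f t \<longleftrightarrow> (\<forall>n>0. grid_avoids K f t n)"
proof
  show "\<forall>n>0. grid_avoids K f t n" if "avoids K f t"
    using avoids_imp_grid[OF that assms(2)] by blast
  show "avoids K f t" if g: "\<forall>n>0. grid_avoids K f t n"
  proof (rule ccontr)
    assume "\<not> avoids K f t"
    from grid_detects_entry[OF assms this] obtain m where "\<forall>n\<ge>m. 0 < n \<longrightarrow> \<not> grid_avoids K f t n" ..
    then have "\<not> grid_avoids K f t (Suc m)" by auto
    with g show False by blast
  qed
qed

text \<open>For right-continuous paths this is the event \<open>sigma X e < sigma X e'\<close>, without reference to infima.\<close>

definition enters_before :: "'a \<Rightarrow> 'a \<Rightarrow> (real \<Rightarrow> 'a) \<Rightarrow> bool" where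
  "enters_before e e' f \<longleftrightarrow> (\<exists>w\<in>entries e f. avoids {e'} f w)"

text \<open>This is where right-continuity excludes a tie: the path stays away from \<open>e'\<close> for a short while after \<open>w\<close>.\<close>

lemma avoids_right_open:
  assumes f: "right_const f" and "0 \<le> w" "avoids {e'} f w" "f w \<noteq> e'"
  shows "\<exists>d>0. \<forall>w'<w + d. avoids {e'} f w'"
proof -
  obtain d where d: "d > 0" "\<And>x. w \<le> x \<Longrightarrow> x < w + d \<Longrightarrow> f x = f w"
    using f assms(2) unfolding right_const_def by meson
  have "w' < v" if "w' < w + d" "v \<in> entries e' f" for w' v
  proof (rule ccontr)
    assume "\<not> w' < v"
    moreover have "w < v" using assms(3) that by (simp add: avoids_def)
    ultimately have "f v = f w" using that by (intro d(2)) auto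
    then show False using that assms(4) by (simp add: entries_def)
  qed
  then show ?thesis using d(1) by (auto simp: avoids_def)
qed

lemma Inf_ereal_less_iff:
  fixes A B :: "real set"
  shows "Inf (ereal ` A) < Inf (ereal ` B) \<longleftrightarrow> (\<exists>a\<in>A. \<exists>d>0. \<forall>b\<in>B. a + d \<le> b)"
proof
  assume "Inf (ereal ` A) < Inf (ereal ` B)"
  then obtain a where a: "a \<in> A" "ereal a < Inf (ereal ` B)"
    by (auto simp: Inf_less_iff)
  then obtain c where c: "ereal a < c" "c < Inf (ereal ` B)" using dense by blast
  then obtain r where r: "c = ereal r" by (cases c) auto
  have "a + (r - a) \<le> b" if "b \<in> B" for b
  proof -
    have "c < ereal b" using c that by (meson INF_lower order_less_le_trans)
    then show ?thesis using r by simp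
  qed
  moreover have "r - a > 0" using c r by simp
  ultimately show "\<exists>a\<in>A. \<exists>d>0. \<forall>b\<in>B. a + d \<le> b" using a by blast
next
  assume "\<exists>a\<in>A. \<exists>d>0. \<forall>b\<in>B. a + d \<le> b"
  then obtain a d where a: "a \<in> A" "d > 0" "\<forall>b\<in>B. a + d \<le> b" by blast
  have "Inf (ereal ` A) \<le> ereal a" using a by (intro INF_lower)
  also have "ereal a < ereal (a + d)" using a by simp
  also have "\<dots> \<le> Inf (ereal ` B)" using a by (intro INF_greatest) simp
  finally show "Inf (ereal ` A) < Inf (ereal ` B)" .
qed

lemma sigma_less_iff:
  assumes f: "right_const (\<lambda>t. X t \<omega>)" and "e \<noteq> e'"
  shows "sigma X e \<omega> < sigma X e' \<omega> \<longleftrightarrow> enters_before e e' (\<lambda>t. X t \<omega>)"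
  unfolding sigma_eq_Inf_entries Inf_ereal_less_iff enters_before_def
proof (intro bex_cong refl)
  fix w assume w: "w \<in> entries e (\<lambda>t. X t \<omega>)"
  then have w0: "0 \<le> w" "X w \<omega> \<noteq> e'" using entries_pos assms(2) by (fastforce simp: entries_def)+
  show "(\<exists>d>0. \<forall>b\<in>entries e' (\<lambda>t. X t \<omega>). w + d \<le> b) \<longleftrightarrow> avoids {e'} (\<lambda>t. X t \<omega>) w"
  proof
    show "avoids {e'} (\<lambda>t. X t \<omega>) w" if "\<exists>d>0. \<forall>b\<in>entries e' (\<lambda>t. X t \<omega>). w + d \<le> b"
      using that by (force simp: avoids_def)
    assume "avoids {e'} (\<lambda>t. X t \<omega>) w"
    from avoids_right_open[OF f w0(1) this w0(2)] obtain d where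
      d: "d > 0" "\<And>w'. w' < w + d \<Longrightarrow> avoids {e'} (\<lambda>t. X t \<omega>) w'" by auto
    have "w + d \<le> b" if "b \<in> entries e' (\<lambda>t. X t \<omega>)" for b
      using d(2)[of b] that by (force simp: avoids_def)
    then show "\<exists>d>0. \<forall>b\<in>entries e' (\<lambda>t. X t \<omega>). w + d \<le> b" using d(1) by blast
  qed
qed

text \<open>Waiting a little after the entry into \<open>e\<close> changes nothing, so a rational time can witness the event;
  this makes it measurable.\<close>

lemma enters_before_rational:
  assumes f: "right_const f" and "e \<noteq> e'"
  shows "enters_before e e' f \<longleftrightarrow>
    (\<exists>q::rat. 0 \<le> q \<and> \<not> avoids {e} f (of_rat q) \<and> avoids {e'} f (of_rat q))"
proof
  assume "enters_before e e' f"
  then obtain w where w: "w \<in> entries e f" "avoids {e'} f w" by (auto simp: enters_before_def)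
  then have w0: "0 \<le> w" "f w \<noteq> e'" using entries_pos assms(2) by (fastforce simp: entries_def)+
  from avoids_right_open[OF f w0(1) w(2) w0(2)] obtain d where
    d: "d > 0" "\<And>w'. w' < w + d \<Longrightarrow> avoids {e'} f w'" by auto
  obtain q where q: "w < of_rat q" "of_rat q < w + d" using of_rat_dense d(1) by (metis less_add_same_cancel1)
  have "0 \<le> q" using q(1) w0(1) by (metis less_eq_real_def order.trans zero_le_of_rat_iff)
  moreover have "\<not> avoids {e} f (of_rat q)" using w(1) q(1) by (force simp: avoids_def)
  ultimately show "\<exists>q::rat. 0 \<le> q \<and> \<not> avoids {e} f (of_rat q) \<and> avoids {e'} f (of_rat q)"
    using d(2) q by blast
next
  assume "\<exists>q::rat. 0 \<le> q \<and> \<not> avoids {e} f (of_rat q) \<and> avoids {e'} f (of_rat q)"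
  then obtain q :: rat where q: "\<not> avoids {e} f (of_rat q)" "avoids {e'} f (of_rat q)" by blast
  then obtain w where "w \<in> entries e f" "w \<le> of_rat q" by (force simp: avoids_def)
  with q(2) show "enters_before e e' f" unfolding enters_before_def by (meson avoids_mono)
qed

text \<open>At a time \<open>t\<close> when the path is outside \<open>{e, e'}\<close>, the later entries of the path are those of the shifted
  path. Given that neither state was entered before, the race between \<open>e\<close> and \<open>e'\<close> thus starts afresh.
  Under \<open>avoids {e} f t\<close> alone, the race being won by \<open>e\<close> already excludes an entry into \<open>e'\<close> up to \<open>t\<close>.\<close>

lemma enters_before_from:
  assumes t: "0 \<le> t" and ne: "f t \<notin> {e, e'}" "e \<noteq> e'"
  shows "avoids {e, e'} f t \<and> enters_before e e' (\<lambda>v. f (t + v)) \<longleftrightarrow>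
    avoids {e} f t \<and> enters_before e e' f"
proof -
  have E: "w \<in> entries e f \<longleftrightarrow> w - t \<in> entries e (\<lambda>v. f (t + v))" if "avoids {e} f t" for w
  proof
    assume w: "w \<in> entries e f"
    then have "t < w" using that by (simp add: avoids_def)
    with w ne t show "w - t \<in> entries e (\<lambda>v. f (t + v))"
      by (auto simp: entries_def intro!: exI[of _ 0])
  next
    assume "w - t \<in> entries e (\<lambda>v. f (t + v))"
    then obtain u where "f w = e" "0 \<le> u" "u < w - t" "f (t + u) \<noteq> e" by (auto simp: entries_def)
    then show "w \<in> entries e f" using t by (auto simp: entries_def intro!: exI[of _ "t + u"])
  qed
  show ?thesis
  proof
    assume L: "avoids {e, e'} f t \<and> enters_before e e' (\<lambda>v. f (t + v))"
    then have a: "avoids {e} f t" "avoids {e'} f t" by (auto simp: avoids_def)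
    from L obtain v where v: "v \<in> entries e (\<lambda>v. f (t + v))" "avoids {e'} (\<lambda>v. f (t + v)) v"
      by (auto simp: enters_before_def)
    then have "t + v \<in> entries e f" using E[OF a(1), of "t + v"] by simp
    moreover have "avoids {e'} f (t + v)" using avoids_add[OF t, of v "{e'}" f] v a entries_pos[OF v(1)] by auto
    ultimately show "avoids {e} f t \<and> enters_before e e' f" using a by (auto simp: enters_before_def)
  next
    assume R: "avoids {e} f t \<and> enters_before e e' f"
    then obtain w where w: "w \<in> entries e f" "avoids {e'} f w" by (auto simp: enters_before_def)
    then have tw: "t < w" using R by (simp add: avoids_def)
    have "avoids {e'} (\<lambda>v. f (t + v)) (w - t)" using avoids_add[OF t, of "w - t" "{e'}" f] w tw by simp
    moreover have "avoids {e'} f t" using avoids_mono[OF w(2)] tw by simp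
    ultimately show "avoids {e, e'} f t \<and> enters_before e e' (\<lambda>v. f (t + v))"
      using R E[of w] w by (auto simp: enters_before_def avoids_def)
  qed
qed

text \<open>As the path is not at \<open>e\<close> at time \<open>t\<close>, this time is no entry, and \<open>t \<le> v\<close> means \<open>t < v\<close> for entries \<open>v\<close>.\<close>

lemma le_sigma_iff_avoids:
  assumes f: "right_const (\<lambda>t. X t \<omega>)" and t: "0 \<le> t" "X t \<omega> \<noteq> e"
  shows "ereal t \<le> sigma X e \<omega> \<longleftrightarrow> avoids {e} (\<lambda>t. X t \<omega>) t"
proof -
  have "ereal t \<le> sigma X e \<omega> \<longleftrightarrow> (\<forall>v\<in>entries e (\<lambda>t. X t \<omega>). t \<le> v)"
    by (auto simp: sigma_eq_Inf_entries le_INF_iff)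
  also have "\<dots> \<longleftrightarrow> (\<forall>v\<in>entries e (\<lambda>t. X t \<omega>). t < v)"
    using t by (auto simp: less_le entries_def)
  finally show ?thesis by (simp add: avoids_def)
qed

section \<open>The sigma-algebras of the past and of the path\<close>

text \<open>The empty set is added because two cylinders with contradictory prescriptions have empty intersection,
  and an intersection-stable generator is needed.\<close>

definition cylinders :: "real set \<Rightarrow> (real \<Rightarrow> nat) set set" where
  "cylinders T = insert {} {{f. \<forall>v\<in>V. f v = y v} | V y. finite V \<and> V \<subseteq> T}"

definition cyl :: "real set \<Rightarrow> (real \<Rightarrow> nat) measure" where
  "cyl T = Sigma_Algebra.sigma UNIV (cylinders T)"

lemma space_cyl [simp]: "space (cyl T) = UNIV"
  by (simp add: cyl_def)

lemma sets_cyl: "sets (cyl T) = sigma_sets UNIV (cylinders T)"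
  by (simp add: cyl_def)

lemma cylinderI: "finite V \<Longrightarrow> V \<subseteq> T \<Longrightarrow> {f. \<forall>v\<in>V. f v = y v} \<in> cylinders T"
  unfolding cylinders_def by (intro insertI2 CollectI exI conjI) simp_all

lemma cylinderE:
  assumes "A \<in> cylinders T"
  obtains "A = {}" | V y where "A = {f. \<forall>v\<in>V. f v = y v}" "finite V" "V \<subseteq> T"
  using assms unfolding cylinders_def by auto

lemma Int_stable_cylinders: "Int_stable (cylinders T)"
  unfolding Int_stable_def
proof (intro ballI)
  fix a b assume ab: "a \<in> cylinders T" "b \<in> cylinders T"
  show "a \<inter> b \<in> cylinders T"
  proof (cases "a \<inter> b = {}")
    case True
    then show ?thesis by (simp add: cylinders_def)
  next
    case False
    with ab obtain V y W z where
      V: "a = {f. \<forall>v\<in>V. f v = y v}" "finite V" "V \<subseteq> T" and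
      W: "b = {f. \<forall>v\<in>W. f v = z v}" "finite W" "W \<subseteq> T"
      by (auto elim!: cylinderE)
    from False V W have agree: "\<forall>v\<in>V \<inter> W. y v = z v" by auto
    have "a \<inter> b = {f. \<forall>v\<in>V \<union> W. f v = (if v \<in> V then y v else z v)}"
    proof (intro equalityI subsetI)
      fix f assume "f \<in> {f. \<forall>v\<in>V \<union> W. f v = (if v \<in> V then y v else z v)}"
      then have "f v = (if v \<in> V then y v else z v)" if "v \<in> V \<union> W" for v using that by blast
      then have "\<forall>v\<in>V. f v = y v" "\<forall>v\<in>W. f v = z v" using agree by fastforce+
      then show "f \<in> a \<inter> b" using V(1) W(1) by blast
    next
      fix f assume "f \<in> a \<inter> b"
      then have "\<forall>v\<in>V. f v = y v" "\<forall>v\<in>W. f v = z v" using V(1) W(1) by blast+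
      then show "f \<in> {f. \<forall>v\<in>V \<union> W. f v = (if v \<in> V then y v else z v)}" by auto
    qed
    moreover have "finite (V \<union> W)" "V \<union> W \<subseteq> T" using V W by auto
    ultimately show ?thesis by (simp only: cylinderI)
  qed
qed

lemma cyl_coordinate_measurable:
  assumes "v \<in> T"
  shows "(\<lambda>f. f v) \<in> cyl T \<rightarrow>\<^sub>M count_space UNIV"
proof (subst measurable_count_space_eq2_countable, safe)
  fix a :: nat
  have "{f. \<forall>u\<in>{v}. f u = (\<lambda>_. a) u} \<in> cylinders T"
    using assms by (intro cylinderI) auto
  then show "(\<lambda>f. f v) -` {a} \<inter> space (cyl T) \<in> sets (cyl T)"
    by (auto simp: sets_cyl vimage_def intro: sigma_sets.Basic)
qed auto

lemma measurable_cylI: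
  assumes "\<And>v. v \<in> T \<Longrightarrow> (\<lambda>x. Y x v) \<in> M \<rightarrow>\<^sub>M count_space UNIV"
  shows "Y \<in> M \<rightarrow>\<^sub>M cyl T"
  unfolding cyl_def
proof (rule measurable_measure_of)
  fix A assume "A \<in> cylinders T"
  then show "Y -` A \<inter> space M \<in> sets M"
  proof (cases rule: cylinderE)
    case (2 V y)
    have "{x \<in> space M. \<forall>v\<in>V. Y x v = y v} \<in> sets M"
      using 2 by (intro sets.sets_Collect_finite_All measurable_sets_Collect[OF assms]) auto
    also have "{x \<in> space M. \<forall>v\<in>V. Y x v = y v} = Y -` A \<inter> space M" using 2 by auto
    finally show ?thesis .
  qed simp
qed auto

lemma sets_cyl_mono:
  assumes "T \<subseteq> T'"
  shows "sets (cyl T) \<subseteq> sets (cyl T')"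
proof -
  have "cylinders T \<subseteq> cylinders T'"
  proof
    fix A assume "A \<in> cylinders T"
    then show "A \<in> cylinders T'"
    proof (cases rule: cylinderE)
      case (2 V y)
      then show ?thesis using assms cylinderI[of V T' y] by (simp only: subset_trans)
    qed (simp add: cylinders_def)
  qed
  then show ?thesis unfolding sets_cyl by (rule sigma_sets_mono')
qed

lemma subset_Pow_UNIV: "G \<subseteq> Pow UNIV" by simp

text \<open>Dynkin's argument for two laws of paths at once. The two sides may use different measures, path maps
  and events \<open>E\<close>, \<open>E'\<close>: this serves to extend the Markov property from cylinders both to general past
  events (with one measure and two events) and to general future events (with two starting points).\<close>

lemma cyl_measure_eqI:
  assumes M: "finite_measure M" "Y \<in> M \<rightarrow>\<^sub>M cyl T" "E \<in> sets M"
    and N: "finite_measure N" "Z \<in> N \<rightarrow>\<^sub>M cyl T" "E' \<in> sets N"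
    and eq: "\<And>V y. finite V \<Longrightarrow> V \<subseteq> T \<Longrightarrow>
      c * measure M {x\<in>E. \<forall>v\<in>V. Y x v = y v} = d * measure N {x\<in>E'. \<forall>v\<in>V. Z x v = y v}"
    and A: "A \<in> sets (cyl T)"
  shows "c * measure M {x\<in>E. Y x \<in> A} = d * measure N {x\<in>E'. Z x \<in> A}"
proof -
  interpret M: finite_measure M by fact
  interpret N: finite_measure N by fact
  have setM: "{x\<in>E. Y x \<in> B} \<in> sets M" if "B \<in> sets (cyl T)" for B
    using sets.Int[OF M(3) measurable_sets[OF M(2) that]] sets.sets_into_space[OF M(3)]
    by (auto simp: Int_def elim!: back_subst[of "\<lambda>A. A \<in> sets M"])
  have setN: "{x\<in>E'. Z x \<in> B} \<in> sets N" if "B \<in> sets (cyl T)" for B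
    using sets.Int[OF N(3) measurable_sets[OF N(2) that]] sets.sets_into_space[OF N(3)]
    by (auto simp: Int_def elim!: back_subst[of "\<lambda>A. A \<in> sets N"])
  show ?thesis
    using Int_stable_cylinders subset_Pow_UNIV A[unfolded sets_cyl]
  proof (induction A rule: sigma_sets_induct_disjoint)
    case (basic B)
    then show ?case by (cases rule: cylinderE) (use eq in auto)
  next
    case (compl B)
    then have B: "B \<in> sets (cyl T)" by (simp add: sets_cyl)
    have "{x\<in>E. Y x \<in> UNIV - B} = E - {x\<in>E. Y x \<in> B}" "{x\<in>E'. Z x \<in> UNIV - B} = E' - {x\<in>E'. Z x \<in> B}"
      by auto
    then show ?case
      using compl.IH eq[of "{}"] M.finite_measure_Diff[OF M(3) setM[OF B]] N.finite_measure_Diff[OF N(3) setN[OF B]]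
      by (simp add: right_diff_distrib Collect_conj_eq)
  next
    case (union B)
    then have B: "B i \<in> sets (cyl T)" for i by (auto simp: sets_cyl)
    have "(\<lambda>i. measure M {x\<in>E. Y x \<in> B i}) sums measure M (\<Union>i. {x\<in>E. Y x \<in> B i})"
      using setM[OF B] union(1) by (intro M.finite_measure_UNION) (auto simp: disjoint_family_on_def)
    then have sM: "(\<lambda>i. c * measure M {x\<in>E. Y x \<in> B i}) sums (c * measure M (\<Union>i. {x\<in>E. Y x \<in> B i}))"
      by (rule sums_mult)
    have "(\<lambda>i. measure N {x\<in>E'. Z x \<in> B i}) sums measure N (\<Union>i. {x\<in>E'. Z x \<in> B i})"
      using setN[OF B] union(1) by (intro N.finite_measure_UNION) (auto simp: disjoint_family_on_def)
    then have sN: "(\<lambda>i. d * measure N {x\<in>E'. Z x \<in> B i}) sums (d * measure N (\<Union>i. {x\<in>E'. Z x \<in> B i}))"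
      by (rule sums_mult)
    have "c * measure M (\<Union>i. {x\<in>E. Y x \<in> B i}) = d * measure N (\<Union>i. {x\<in>E'. Z x \<in> B i})"
      by (rule sums_unique2[OF sM]) (simp only: union.IH sN)
    moreover have "(\<Union>i. {x\<in>E. Y x \<in> B i}) = {x\<in>E. Y x \<in> \<Union> (range B)}"
      "(\<Union>i. {x\<in>E'. Z x \<in> B i}) = {x\<in>E'. Z x \<in> \<Union> (range B)}" by auto
    ultimately show ?case by (simp only:)
  qed auto
qed

text \<open>Quantifying over all grids replaces uncountably many times by countably many, at no cost on
  right-continuous paths.\<close>

definition avoid_paths :: "'a set \<Rightarrow> real \<Rightarrow> (real \<Rightarrow> 'a) set" where
  "avoid_paths K t = {f. \<forall>n>0. grid_avoids K f t n}"

lemma avoid_paths_iff: "right_const f \<Longrightarrow> 0 \<le> t \<Longrightarrow> f \<in> avoid_paths K t \<longleftrightarrow> avoids K f t"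
  by (simp add: avoid_paths_def avoids_iff_grid)

lemma grid_time_le: "0 \<le> t \<Longrightarrow> k \<le> n \<Longrightarrow> real k * t / real n \<le> t"
  by (cases "n = 0") (simp_all add: pos_divide_le_eq mult.commute mult_left_mono)

lemma step_event:
  assumes Y: "\<And>t. t \<in> {a, b} \<Longrightarrow> (\<lambda>x. Y x t) \<in> M \<rightarrow>\<^sub>M count_space (UNIV :: nat set)"
  shows "{x\<in>space M. Y x b \<in> K \<longrightarrow> Y x a = Y x b} \<in> sets M"
proof -
  have [measurable]: "(\<lambda>x. Y x a) \<in> M \<rightarrow>\<^sub>M count_space UNIV" "(\<lambda>x. Y x b) \<in> M \<rightarrow>\<^sub>M count_space UNIV"
    using Y by auto
  have "{x\<in>space M. Y x b \<in> K \<longrightarrow> Y x a = Y x b} = {x\<in>space M. Y x b \<in> K \<longrightarrow> (\<exists>c. Y x a = c \<and> Y x b = c)}"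
    by auto
  also have "\<dots> \<in> sets M" by measurable
  finally show ?thesis .
qed

lemma grid_event:
  assumes Y: "\<And>v. 0 \<le> v \<Longrightarrow> v \<le> t \<Longrightarrow> (\<lambda>x. Y x v) \<in> M \<rightarrow>\<^sub>M count_space (UNIV :: nat set)" and t: "0 \<le> t"
  shows "{x\<in>space M. grid_avoids K (Y x) t n} \<in> sets M"
proof -
  have "{x\<in>space M. \<forall>k\<in>{..<n}. Y x (real (Suc k) * t / real n) \<in> K \<longrightarrow>
      Y x (real k * t / real n) = Y x (real (Suc k) * t / real n)} \<in> sets M"
  proof (intro sets.sets_Collect_finite_All step_event Y)
    fix k v assume k: "k \<in> {..<n}" and "v \<in> {real k * t / real n, real (Suc k) * t / real n}"
    then have "\<exists>k'\<le>n. v = real k' * t / real n" by (metis Suc_leI empty_iff insert_iff lessThan_iff less_imp_le)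
    then show "0 \<le> v" "v \<le> t" using t grid_time_le by auto
  qed simp
  then show ?thesis by (simp only: grid_avoids_def Ball_def lessThan_iff)
qed

lemma avoid_paths_event:
  assumes "0 \<le> t" "{0..t} \<subseteq> T"
  shows "avoid_paths K t \<in> sets (cyl T)"
proof -
  have "{f\<in>space (cyl T). grid_avoids K (id f) t n} \<in> sets (cyl T)" for n
    using assms by (intro grid_event) (auto intro: cyl_coordinate_measurable)
  then have "{f\<in>space (cyl T). \<forall>n\<in>{0<..}. grid_avoids K (id f) t n} \<in> sets (cyl T)"
    by (intro sets.sets_Collect_countable_Ball) auto
  then show ?thesis by (simp add: avoid_paths_def Ball_def)
qed

lemma coordinate_event: "v \<in> T \<Longrightarrow> {f. f v = a} \<in> sets (cyl T)"
  using measurable_sets[OF cyl_coordinate_measurable, of v T "{a}"] by (simp add: vimage_def)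

definition enters_before_paths :: "'a \<Rightarrow> 'a \<Rightarrow> (real \<Rightarrow> 'a) set" where
  "enters_before_paths e e' = (\<Union>q\<in>{0::rat..}. avoid_paths {e'} (of_rat q) - avoid_paths {e} (of_rat q))"

lemma enters_before_paths_iff:
  assumes "right_const f" "e \<noteq> e'"
  shows "f \<in> enters_before_paths e e' \<longleftrightarrow> enters_before e e' f"
  using assms by (auto simp: enters_before_paths_def enters_before_rational avoid_paths_iff)

lemma enters_before_paths_event: "enters_before_paths e e' \<in> sets (cyl {0..})"
  unfolding enters_before_paths_def
proof (intro sets.countable_UN image_subsetI)
  fix q :: rat assume "q \<in> {0..}"
  then show "avoid_paths {e'} (of_rat q) - avoid_paths {e} (of_rat q) \<in> sets (cyl {0..})"
    by (intro sets.Diff avoid_paths_event) auto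
qed

section \<open>The Markov property for past and future\<close>

context markov_chain
begin

definition trans_prob :: "real \<Rightarrow> nat \<Rightarrow> nat \<Rightarrow> real" where
  "trans_prob h k l = \<P>(\<omega> in P k. X h \<omega> = l)"

lemma space_law [simp]: "i \<in> {1..s} \<Longrightarrow> space (P i) = space F"
  using law_sets sets_eq_imp_space_eq by blast

lemma law_finite_measure: "i \<in> {1..s} \<Longrightarrow> finite_measure (P i)"
  using law_prob_space prob_space.finite_measure by blast

lemma X_states: "0 \<le> t \<Longrightarrow> \<omega> \<in> space F \<Longrightarrow> X t \<omega> \<in> {1..s}"
  using state_measurable[THEN measurable_space, of t \<omega>] by simp

lemma X_measurable_F: "0 \<le> t \<Longrightarrow> X t \<in> F \<rightarrow>\<^sub>M count_space UNIV"
  using measurable_compose[OF state_measurable, of t id "count_space UNIV"] by (simp add: id_def)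

lemma X_measurable: "i \<in> {1..s} \<Longrightarrow> 0 \<le> t \<Longrightarrow> X t \<in> P i \<rightarrow>\<^sub>M count_space UNIV"
  using X_measurable_F measurable_cong_sets[OF law_sets refl] by blast

lemma shifted_path_measurable:
  "i \<in> {1..s} \<Longrightarrow> 0 \<le> t \<Longrightarrow> T \<subseteq> {0..} \<Longrightarrow> (\<lambda>\<omega> v. X (t + v) \<omega>) \<in> P i \<rightarrow>\<^sub>M cyl T"
  by (intro measurable_cylI X_measurable) auto

lemma path_measurable:
  "i \<in> {1..s} \<Longrightarrow> T \<subseteq> {0..} \<Longrightarrow> (\<lambda>\<omega> v. X v \<omega>) \<in> P i \<rightarrow>\<^sub>M cyl T"
  using shifted_path_measurable[of i 0] by simp

lemma path_event:
  assumes "i \<in> {1..s}" "0 \<le> t" "A \<in> sets (cyl {0..})"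
  shows "{\<omega>\<in>space (P i). (\<lambda>v. X (t + v) \<omega>) \<in> A} \<in> sets (P i)"
  using measurable_sets[OF shifted_path_measurable[of i t "{0..}"] assms(3)] assms(1,2)
  by (simp add: vimage_def Int_def conj_commute)

lemma X_event: "i \<in> {1..s} \<Longrightarrow> 0 \<le> t \<Longrightarrow> {\<omega>\<in>space (P i). X t \<omega> = k} \<in> sets (P i)"
  by (rule measurable_sets_Collect[OF X_measurable]) auto

lemma trans_prob_outside: "k \<in> {1..s} \<Longrightarrow> 0 \<le> h \<Longrightarrow> l \<notin> {1..s} \<Longrightarrow> trans_prob h k l = 0"
proof -
  assume a: "k \<in> {1..s}" "0 \<le> h" "l \<notin> {1..s}"
  then have "{\<omega> \<in> space (P k). X h \<omega> = l} = {}" using X_states[of h] by auto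
  then show ?thesis by (simp only: trans_prob_def measure_empty)
qed

text \<open>The assumed Markov property as a product formula, which also covers conditions of probability zero.\<close>

lemma markov_step_cylinder:
  assumes i: "i \<in> {1..s}" and th: "0 \<le> t" "0 \<le> h" and U: "finite U" "U \<subseteq> {0..t}"
  shows "\<P>(\<omega> in P i. (X t \<omega> = k \<and> X (t + h) \<omega> = l) \<and> (\<forall>u\<in>U. X u \<omega> = x u)) =
    trans_prob h k l * \<P>(\<omega> in P i. X t \<omega> = k \<and> (\<forall>u\<in>U. X u \<omega> = x u))"
proof (cases "k \<in> {1..s} \<and> l \<in> {1..s}")
  case False
  then have "{\<omega>\<in>space (P i). (X t \<omega> = k \<and> X (t + h) \<omega> = l) \<and> (\<forall>u\<in>U. X u \<omega> = x u)} = {}"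
    using X_states[of t] X_states[of "t + h"] th i by auto
  moreover have "trans_prob h k l = 0 \<or> {\<omega>\<in>space (P i). X t \<omega> = k \<and> (\<forall>u\<in>U. X u \<omega> = x u)} = {}"
    using False X_states[of t] th i trans_prob_outside[of k h l] by auto
  ultimately show ?thesis by (elim disjE) (simp_all only: measure_empty mult_zero_left mult_zero_right)
next
  case True
  let ?A = "\<lambda>\<omega>. X t \<omega> = k \<and> (\<forall>u\<in>U. X u \<omega> = x u)"
  let ?p = "\<P>(\<omega> in P i. ?A \<omega>)"
  have com: "\<P>(\<omega> in P i. (X t \<omega> = k \<and> X (t + h) \<omega> = l) \<and> (\<forall>u\<in>U. X u \<omega> = x u))
     = \<P>(\<omega> in P i. X (t + h) \<omega> = l \<and> ?A \<omega>)"
    by (intro arg_cong[where f = "measure (P i)"]) auto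
  interpret Pi: prob_space "P i" using law_prob_space[OF i] .
  show ?thesis
  proof (cases "?p = 0")
    case True
    have "{\<omega>\<in>space (P i). ?A \<omega>} \<in> sets (P i)"
    proof -
      have "{\<omega>\<in>space (P i). \<forall>u\<in>U. X u \<omega> = x u} \<in> sets (P i)"
        by (intro sets.sets_Collect_finite_All X_event i) (use U in auto)
      then show ?thesis by (rule sets.sets_Collect_conj[OF _ X_event[OF i th(1)]])
    qed
    then have "\<P>(\<omega> in P i. X (t + h) \<omega> = l \<and> ?A \<omega>) \<le> ?p"
      by (intro Pi.finite_measure_mono) auto
    then show ?thesis using True com by (simp add: measure_le_0_iff)
  next
    case False
    then show ?thesis
      using markov_property[OF i conjunct1[OF True] conjunct2[OF True] th U False] com
      by (simp add: cond_prob_def trans_prob_def field_simps)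
  qed
qed

lemma markov_step:
  assumes i: "i \<in> {1..s}" and th: "0 \<le> t" "0 \<le> h" and A: "A \<in> sets (cyl {0..t})"
  shows "\<P>(\<omega> in P i. (\<lambda>v. X v \<omega>) \<in> A \<and> X t \<omega> = k \<and> X (t + h) \<omega> = l) =
    \<P>(\<omega> in P i. (\<lambda>v. X v \<omega>) \<in> A \<and> X t \<omega> = k) * trans_prob h k l"
proof -
  let ?E = "{\<omega>\<in>space (P i). X t \<omega> = k \<and> X (t + h) \<omega> = l}"
  let ?E' = "{\<omega>\<in>space (P i). X t \<omega> = k}"
  have Y: "(\<lambda>\<omega> v. X v \<omega>) \<in> P i \<rightarrow>\<^sub>M cyl {0..t}"
    using i by (intro path_measurable) auto
  have "?E \<in> sets (P i)"
    using i th by (intro sets.sets_Collect_conj X_event) auto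
  then have "1 * measure (P i) {\<omega>\<in>?E. (\<lambda>v. X v \<omega>) \<in> A} = trans_prob h k l * measure (P i) {\<omega>\<in>?E'. (\<lambda>v. X v \<omega>) \<in> A}"
    using markov_step_cylinder[OF i th] X_event[OF i th(1)]
    by (intro cyl_measure_eqI[OF law_finite_measure[OF i] Y _ law_finite_measure[OF i] Y _ _ A]) auto
  then show ?thesis by (simp add: conj_ac mult.commute)
qed

text \<open>Induction on the latest future time: the step from the second latest time to it is one Markov step
  under the law of \<open>P i\<close>, and the same step under the law of \<open>P k\<close>.\<close>

lemma markov_cylinder:
  assumes i: "i \<in> {1..s}" and k: "k \<in> {1..s}" and t: "0 \<le> t" and A: "A \<in> sets (cyl {0..t})"
    and V: "finite V" "V \<subseteq> {0..}"
  shows "\<P>(\<omega> in P i. (\<lambda>v. X v \<omega>) \<in> A \<and> X t \<omega> = k \<and> (\<forall>v\<in>V. X (t + v) \<omega> = y v)) =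
    \<P>(\<omega> in P i. (\<lambda>v. X v \<omega>) \<in> A \<and> X t \<omega> = k) * \<P>(\<omega> in P k. \<forall>v\<in>V. X v \<omega> = y v)"
  using V
proof (induction V rule: finite_linorder_max_induct)
  case empty
  then show ?case using law_prob_space[OF k] by (simp add: prob_space.prob_space)
next
  case (insert m V)
  show ?case
  proof (cases "V = {}")
    case True
    then show ?thesis using markov_step[OF i t _ A, of m k "y m"] insert by (simp add: trans_prob_def)
  next
    case False
    \<comment> \<open>The Markov step starts at the second latest time, whose state the cylinder prescribes.\<close>
    define m' where "m' = Max V"
    have m': "m' \<in> V" "\<And>v. v \<in> V \<Longrightarrow> v \<le> m'"
      using False insert.hyps unfolding m'_def by (auto intro: Max_in)
    then have m'_bounds: "m' < m" "0 \<le> m'" using insert.hyps insert.prems by auto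
    note m' = m' m'_bounds
    define B where "B = {f. f \<in> A \<and> f t = k \<and> (\<forall>v\<in>V. f (t + v) = y v)}"
    define C where "C = {f :: real \<Rightarrow> nat. \<forall>v\<in>V. f v = y v}"
    have coord: "{f. f v = a} \<in> sets (cyl T)" if "v \<in> T" for v a T
      using measurable_sets[OF cyl_coordinate_measurable[OF that], of "{a}"] by (simp add: vimage_def)
    have B: "B \<in> sets (cyl {0..t + m'})"
    proof -
      have "A \<in> sets (cyl {0..t + m'})" using A sets_cyl_mono[of "{0..t}" "{0..t + m'}"] m' by auto
      moreover have "{f. f t = k} \<in> sets (cyl {0..t + m'})" using t m' by (intro coord) auto
      moreover have "{f. f \<in> space (cyl {0..t + m'}) \<and> (\<forall>v\<in>V. f (t + v) = y v)} \<in> sets (cyl {0..t + m'})"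
        using t m' insert.hyps insert.prems by (intro sets.sets_Collect_finite_All) (auto intro!: coord)
      ultimately have "A \<inter> {f. f t = k} \<inter> {f. f \<in> space (cyl {0..t + m'}) \<and> (\<forall>v\<in>V. f (t + v) = y v)} \<in> sets (cyl {0..t + m'})"
        by (intro sets.Int)
      then show ?thesis unfolding B_def by (simp add: Int_def conj_ac)
    qed
    have C: "C \<in> sets (cyl {0..m'})"
    proof -
      have "{f. f \<in> space (cyl {0..m'}) \<and> (\<forall>v\<in>V. f v = y v)} \<in> sets (cyl {0..m'})"
        using m' insert.hyps insert.prems by (intro sets.sets_Collect_finite_All) (auto intro!: coord)
      then show ?thesis by (simp add: C_def)
    qed
    have "\<P>(\<omega> in P i. (\<lambda>v. X v \<omega>) \<in> A \<and> X t \<omega> = k \<and> (\<forall>v\<in>insert m V. X (t + v) \<omega> = y v)) =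
        \<P>(\<omega> in P i. (\<lambda>v. X v \<omega>) \<in> B \<and> X (t + m') \<omega> = y m' \<and> X (t + m' + (m - m')) \<omega> = y m)"
      using m' by (intro arg_cong[where f = "measure (P i)"]) (auto simp: B_def)
    also have "\<dots> = \<P>(\<omega> in P i. (\<lambda>v. X v \<omega>) \<in> B \<and> X (t + m') \<omega> = y m') * trans_prob (m - m') (y m') (y m)"
      using i t m' B by (intro markov_step) auto
    also have "\<P>(\<omega> in P i. (\<lambda>v. X v \<omega>) \<in> B \<and> X (t + m') \<omega> = y m') =
        \<P>(\<omega> in P i. (\<lambda>v. X v \<omega>) \<in> A \<and> X t \<omega> = k \<and> (\<forall>v\<in>V. X (t + v) \<omega> = y v))"
      using m' by (intro arg_cong[where f = "measure (P i)"]) (auto simp: B_def)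
    also have "\<dots> = \<P>(\<omega> in P i. (\<lambda>v. X v \<omega>) \<in> A \<and> X t \<omega> = k) * \<P>(\<omega> in P k. \<forall>v\<in>V. X v \<omega> = y v)"
      using insert by simp
    also have "\<P>(\<omega> in P k. \<forall>v\<in>V. X v \<omega> = y v) = \<P>(\<omega> in P k. (\<lambda>v. X v \<omega>) \<in> C \<and> X m' \<omega> = y m')"
      using m' by (intro arg_cong[where f = "measure (P k)"]) (auto simp: C_def)
    also have "\<P>(\<omega> in P i. (\<lambda>v. X v \<omega>) \<in> A \<and> X t \<omega> = k) * \<dots> * trans_prob (m - m') (y m') (y m) =
       \<P>(\<omega> in P i. (\<lambda>v. X v \<omega>) \<in> A \<and> X t \<omega> = k) *
       \<P>(\<omega> in P k. (\<lambda>v. X v \<omega>) \<in> C \<and> X m' \<omega> = y m' \<and> X (m' + (m - m')) \<omega> = y m)"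
      using k m' C by (subst markov_step) auto
    also have "\<P>(\<omega> in P k. (\<lambda>v. X v \<omega>) \<in> C \<and> X m' \<omega> = y m' \<and> X (m' + (m - m')) \<omega> = y m) =
        \<P>(\<omega> in P k. \<forall>v\<in>insert m V. X v \<omega> = y v)"
      using m' by (intro arg_cong[where f = "measure (P k)"]) (auto simp: C_def)
    finally show ?thesis .
  qed
qed

theorem markov_past_future:
  assumes i: "i \<in> {1..s}" and k: "k \<in> {1..s}" and t: "0 \<le> t"
    and A: "A \<in> sets (cyl {0..t})" and B: "B \<in> sets (cyl {0..})"
  shows "\<P>(\<omega> in P i. (\<lambda>v. X v \<omega>) \<in> A \<and> X t \<omega> = k \<and> (\<lambda>v. X (t + v) \<omega>) \<in> B) =
    \<P>(\<omega> in P i. (\<lambda>v. X v \<omega>) \<in> A \<and> X t \<omega> = k) * \<P>(\<omega> in P k. (\<lambda>v. X v \<omega>) \<in> B)"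
proof -
  let ?E = "{\<omega>\<in>space (P i). (\<lambda>v. X v \<omega>) \<in> A \<and> X t \<omega> = k}"
  have "A \<in> sets (cyl {0..})" using A sets_cyl_mono[of "{0..t}" "{0..}"] by auto
  then have "?E \<in> sets (P i)"
    using path_event[OF i, of 0 A] X_event[OF i t] by (intro sets.sets_Collect_conj) auto
  then have "1 * measure (P i) {\<omega>\<in>?E. (\<lambda>v. X (t + v) \<omega>) \<in> B} =
      measure (P i) ?E * measure (P k) {\<omega>\<in>space (P k). (\<lambda>v. X v \<omega>) \<in> B}"
    using markov_cylinder[OF i k t A] t i k
    by (intro cyl_measure_eqI[OF law_finite_measure[OF i] shifted_path_measurable _
        law_finite_measure[OF k] path_measurable sets.top _ B]) (auto simp: conj_assoc)
  then show ?thesis by (simp add: conj_assoc)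
qed

end

section \<open>The chain killed at entries, and its generator\<close>

context markov_chain
begin

lemma right_const_path:
  assumes "\<omega> \<in> space F"
  shows "right_const (\<lambda>v. X v \<omega>)"
  unfolding right_const_def
proof (intro allI impI)
  fix t :: real assume t: "0 \<le> t"
  have "((\<lambda>u. X u \<omega>) \<longlongrightarrow> X t \<omega>) (at_right t)"
    using right_continuous[OF assms t] by (simp add: continuous_within)
  then have "\<forall>\<^sub>F u in at_right t. X u \<omega> = X t \<omega>"
    by (simp add: tendsto_discrete)
  then obtain b where b: "b > t" "\<And>u. t < u \<Longrightarrow> u < b \<Longrightarrow> X u \<omega> = X t \<omega>"
    unfolding eventually_at_right_field by blast
  show "\<exists>d>0. \<forall>u\<ge>t. u < t + d \<longrightarrow> X u \<omega> = X t \<omega>"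
    by (rule exI[of _ "b - t"]) (use b in \<open>auto simp: le_less\<close>)
qed

lemma right_const_shifted_path:
  assumes "\<omega> \<in> space F" "0 \<le> t"
  shows "right_const (\<lambda>v. X (t + v) \<omega>)"
  unfolding right_const_def
proof (intro allI impI)
  fix v :: real assume "0 \<le> v"
  then obtain d where d: "d > 0" "\<And>u. t + v \<le> u \<Longrightarrow> u < t + v + d \<Longrightarrow> X u \<omega> = X (t + v) \<omega>"
    using right_const_path[OF assms(1)] assms(2) unfolding right_const_def by (metis add_nonneg_nonneg)
  show "\<exists>d>0. \<forall>u\<ge>v. u < v + d \<longrightarrow> X (t + u) \<omega> = X (t + v) \<omega>"
    by (rule exI[of _ d]) (use d(1) in \<open>auto intro!: d(2)\<close>)
qed

text \<open>The transition probabilities of the chain killed at its first entry into \<open>K\<close>.\<close>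

definition killed :: "nat set \<Rightarrow> real \<Rightarrow> nat \<Rightarrow> nat \<Rightarrow> real" where
  "killed K t i j = \<P>(\<omega> in P i. avoids K (\<lambda>v. X v \<omega>) t \<and> X t \<omega> = j)"

definition survival :: "nat set \<Rightarrow> real \<Rightarrow> nat \<Rightarrow> real" where
  "survival K t i = \<P>(\<omega> in P i. avoids K (\<lambda>v. X v \<omega>) t)"

lemma avoids_event:
  assumes i: "i \<in> {1..s}" and t: "0 \<le> t"
  shows "{\<omega>\<in>space (P i). avoids K (\<lambda>v. X v \<omega>) t} \<in> sets (P i)"
proof -
  have "{\<omega>\<in>space (P i). (\<lambda>v. X (0 + v) \<omega>) \<in> avoid_paths K t} \<in> sets (P i)"
    using i t by (intro path_event avoid_paths_event) auto
  also have "{\<omega>\<in>space (P i). (\<lambda>v. X (0 + v) \<omega>) \<in> avoid_paths K t} = {\<omega>\<in>space (P i). avoids K (\<lambda>v. X v \<omega>) t}"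
    using avoid_paths_iff[OF right_const_path t] i by auto
  finally show ?thesis .
qed

lemma partition_by_state:
  assumes i: "i \<in> {1..s}" and t: "0 \<le> t" and S: "{\<omega>\<in>space (P i). S \<omega>} \<in> sets (P i)"
  shows "\<P>(\<omega> in P i. S \<omega>) = (\<Sum>k\<in>{1..s}. \<P>(\<omega> in P i. S \<omega> \<and> X t \<omega> = k))"
proof -
  interpret Pi: prob_space "P i" using law_prob_space[OF i] .
  have "{\<omega>\<in>space (P i). S \<omega>} = (\<Union>k\<in>{1..s}. {\<omega>\<in>space (P i). S \<omega> \<and> X t \<omega> = k})"
    using X_states[OF t] i by auto
  also have "measure (P i) \<dots> = (\<Sum>k\<in>{1..s}. \<P>(\<omega> in P i. S \<omega> \<and> X t \<omega> = k))"
    using sets.sets_Collect_conj[OF X_event[OF i t] S]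
    by (intro Pi.finite_measure_finite_Union) (auto simp: disjoint_family_on_def)
  finally show ?thesis .
qed

lemma killed_nonneg: "0 \<le> killed K t i j"
  by (simp add: killed_def)

lemma survival_le_1: "i \<in> {1..s} \<Longrightarrow> survival K t i \<le> 1"
  using law_prob_space prob_space.prob_le_1 by (force simp: survival_def)

lemma survival_sum: "i \<in> {1..s} \<Longrightarrow> 0 \<le> t \<Longrightarrow> survival K t i = (\<Sum>k\<in>{1..s}. killed K t i k)"
  unfolding survival_def killed_def by (intro partition_by_state avoids_event)

lemma killed_markov:
  assumes i: "i \<in> {1..s}" and k: "k \<in> {1..s}" and t: "0 \<le> t" and B: "B \<in> sets (cyl {0..})"
  shows "\<P>(\<omega> in P i. avoids K (\<lambda>v. X v \<omega>) t \<and> X t \<omega> = k \<and> (\<lambda>v. X (t + v) \<omega>) \<in> B) =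
    killed K t i k * \<P>(\<omega> in P k. (\<lambda>v. X v \<omega>) \<in> B)"
proof -
  have av: "\<omega> \<in> space (P i) \<Longrightarrow> avoids K (\<lambda>v. X v \<omega>) t \<longleftrightarrow> (\<lambda>v. X v \<omega>) \<in> avoid_paths K t" for \<omega>
    using avoid_paths_iff[OF right_const_path t] i by auto
  have "\<P>(\<omega> in P i. avoids K (\<lambda>v. X v \<omega>) t \<and> X t \<omega> = k \<and> (\<lambda>v. X (t + v) \<omega>) \<in> B) =
      \<P>(\<omega> in P i. (\<lambda>v. X v \<omega>) \<in> avoid_paths K t \<and> X t \<omega> = k \<and> (\<lambda>v. X (t + v) \<omega>) \<in> B)"
    using av by (intro arg_cong[where f = "measure (P i)"]) blast
  also have "\<dots> = \<P>(\<omega> in P i. (\<lambda>v. X v \<omega>) \<in> avoid_paths K t \<and> X t \<omega> = k) * \<P>(\<omega> in P k. (\<lambda>v. X v \<omega>) \<in> B)"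
    using i k t B by (intro markov_past_future avoid_paths_event) auto
  also have "\<P>(\<omega> in P i. (\<lambda>v. X v \<omega>) \<in> avoid_paths K t \<and> X t \<omega> = k) = killed K t i k"
    unfolding killed_def using av by (intro arg_cong[where f = "measure (P i)"]) blast
  finally show ?thesis .
qed

text \<open>Split at the state at time \<open>t\<close>. Avoiding \<open>K\<close> up to \<open>t + r\<close> is a past event and a future event
  (\<open>avoids_add\<close>), which the Markov property separates.\<close>

lemma killed_semigroup:
  assumes i: "i \<in> {1..s}" and t: "0 \<le> t" and r: "0 \<le> r"
  shows "killed K (t + r) i j = (\<Sum>k\<in>{1..s}. killed K t i k * killed K r k j)"
proof -
  define B where "B = avoid_paths K r \<inter> {f. f r = j}"
  have B: "B \<in> sets (cyl {0..})"
    unfolding B_def using r by (intro sets.Int avoid_paths_event coordinate_event) auto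
  have memB: "(\<lambda>v. X (u + v) \<omega>) \<in> B \<longleftrightarrow> avoids K (\<lambda>v. X (u + v) \<omega>) r \<and> X (u + r) \<omega> = j"
    if "\<omega> \<in> space F" "0 \<le> u" for \<omega> u
    using avoid_paths_iff[OF right_const_shifted_path[OF that] r] by (simp add: B_def)
  have "{\<omega>\<in>space (P i). avoids K (\<lambda>v. X v \<omega>) (t + r) \<and> X (t + r) \<omega> = j} \<in> sets (P i)"
    using i t r by (intro sets.sets_Collect_conj avoids_event X_event) auto
  then have "killed K (t + r) i j =
      (\<Sum>k\<in>{1..s}. \<P>(\<omega> in P i. (avoids K (\<lambda>v. X v \<omega>) (t + r) \<and> X (t + r) \<omega> = j) \<and> X t \<omega> = k))"
    unfolding killed_def by (rule partition_by_state[OF i t])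
  also have "\<dots> = (\<Sum>k\<in>{1..s}. \<P>(\<omega> in P i. avoids K (\<lambda>v. X v \<omega>) t \<and> X t \<omega> = k \<and> (\<lambda>v. X (t + v) \<omega>) \<in> B))"
    using memB[OF _ t] i t r
    by (intro sum.cong refl arg_cong[where f = "measure (P i)"]) (auto simp: avoids_add)
  also have "\<dots> = (\<Sum>k\<in>{1..s}. killed K t i k * \<P>(\<omega> in P k. (\<lambda>v. X v \<omega>) \<in> B))"
    by (intro sum.cong refl killed_markov i t B) auto
  also have "\<dots> = (\<Sum>k\<in>{1..s}. killed K t i k * killed K r k j)"
  proof (intro sum.cong refl arg_cong2[where f = "(*)"])
    fix k assume k: "k \<in> {1..s}"
    show "\<P>(\<omega> in P k. (\<lambda>v. X v \<omega>) \<in> B) = killed K r k j"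
      unfolding killed_def using memB[of _ 0] k by (intro arg_cong[where f = "measure (P k)"]) auto
  qed
  finally show ?thesis .
qed

lemma survival_add:
  assumes i: "i \<in> {1..s}" and t: "0 \<le> t" and r: "0 \<le> r"
  shows "survival K (t + r) i = (\<Sum>k\<in>{1..s}. killed K t i k * survival K r k)"
proof -
  have "survival K (t + r) i = (\<Sum>j\<in>{1..s}. \<Sum>k\<in>{1..s}. killed K t i k * killed K r k j)"
    using assms by (simp add: survival_sum killed_semigroup)
  also have "\<dots> = (\<Sum>k\<in>{1..s}. \<Sum>j\<in>{1..s}. killed K t i k * killed K r k j)"
    by (rule sum.swap)
  also have "\<dots> = (\<Sum>k\<in>{1..s}. killed K t i k * survival K r k)"
    using r by (intro sum.cong refl) (simp add: survival_sum sum_distrib_left)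
  finally show ?thesis .
qed

lemma killed_le_trans_prob: "i \<in> {1..s} \<Longrightarrow> 0 \<le> t \<Longrightarrow> killed K t i j \<le> trans_prob t i j"
  unfolding killed_def trans_prob_def
  by (intro finite_measure.finite_measure_mono law_finite_measure X_event) auto

lemma trans_prob_nonneg: "0 \<le> trans_prob t i j"
  by (simp add: trans_prob_def)

lemma trans_prob_row_sum: "i \<in> {1..s} \<Longrightarrow> 0 \<le> t \<Longrightarrow> (\<Sum>j\<in>{1..s}. trans_prob t i j) = 1"
  using partition_by_state[of i t "\<lambda>_. True"] prob_space.prob_space[OF law_prob_space, of i]
    sets.top[of "P i"] by (simp add: trans_prob_def)

lemma trans_prob_zero: "i \<in> {1..s} \<Longrightarrow> j \<noteq> i \<Longrightarrow> trans_prob 0 i j = 0"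
  unfolding trans_prob_def
  by (subst prob_space.prob_eq_0[OF law_prob_space X_event]) (use start[of i] in \<open>auto elim!: eventually_mono\<close>)


text \<open>For \<open>K = {1, 2}\<close> these are the entries of \<open>Q\<^sub>0\<close>.\<close>

definition killed_rate :: "nat set \<Rightarrow> nat \<Rightarrow> nat \<Rightarrow> real" where
  "killed_rate K i j = (if j \<in> K \<and> i \<noteq> j then 0 else mat_entry Q i j)"

definition entry_flow :: "nat set \<Rightarrow> real \<Rightarrow> nat \<Rightarrow> real" where
  "entry_flow K h l = (\<Sum>e\<in>K \<inter> {1..s} - {l}. trans_prob h l e)"

lemma entry_flow_rate:
  assumes "l \<in> {1..s}"
  shows "((\<lambda>h. entry_flow K h l / h) \<longlongrightarrow> (\<Sum>e\<in>K \<inter> {1..s} - {l}. mat_entry Q l e)) (at_right 0)"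
  unfolding entry_flow_def sum_divide_distrib trans_prob_def
  using assms by (intro tendsto_sum transition_rate) auto

text \<open>The quotient \<open>trans_prob h i l / h\<close> converges, so its numerator tends to \<open>0\<close>.\<close>

lemma trans_prob_small:
  assumes "i \<in> {1..s}" "\<eta> > 0"
  shows "\<exists>b>0. \<forall>h l. 0 \<le> h \<longrightarrow> h < b \<longrightarrow> l \<in> {1..s} \<longrightarrow> l \<noteq> i \<longrightarrow> trans_prob h i l \<le> \<eta>"
proof -
  have "\<forall>\<^sub>F h in at_right 0. \<forall>l\<in>{1..s} - {i}. trans_prob h i l < \<eta>"
  proof (intro eventually_ball_finite ballI)
    fix l assume l: "l \<in> {1..s} - {i}"
    have "((\<lambda>h. trans_prob h i l / h * h) \<longlongrightarrow> mat_entry Q i l * 0) (at_right 0)"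
      unfolding trans_prob_def using l assms by (intro tendsto_mult transition_rate tendsto_ident_at) auto
    then have "\<forall>\<^sub>F h in at_right 0. trans_prob h i l / h * h < \<eta>"
      using assms(2) by (intro order_tendstoD(2)) auto
    then show "\<forall>\<^sub>F h in at_right 0. trans_prob h i l < \<eta>"
      using eventually_at_right_less[of "0::real"] by eventually_elim simp
  qed simp
  then obtain b where b: "b > 0" "\<And>h. 0 < h \<Longrightarrow> h < b \<Longrightarrow> \<forall>l\<in>{1..s} - {i}. trans_prob h i l < \<eta>"
    unfolding eventually_at_right_field by blast
  have "trans_prob h i l \<le> \<eta>" if "0 \<le> h" "h < b" "l \<in> {1..s}" "l \<noteq> i" for h l
    using b(2)[of h] trans_prob_zero[OF assms(1), of l] that assms(2) by (cases "h = 0") (auto intro: less_imp_le)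
  with b(1) show ?thesis by blast
qed

lemma trans_prob_step:
  assumes "i \<in> {1..s}" "0 \<le> t" "0 \<le> h"
  shows "\<P>(\<omega> in P i. X t \<omega> = k \<and> X (t + h) \<omega> = l) = trans_prob t i k * trans_prob h k l"
  using markov_step[OF assms sets.top, of k l] by (simp add: trans_prob_def)

text \<open>A union bound over the \<open>n\<close> steps of the grid and the state \<open>l\<close> before the step. With \<open>l = i\<close> the probability
  of being at \<open>l\<close> is bounded by \<open>1\<close>; with any other \<open>l\<close> it is at most \<open>\<eta>\<close>, which makes this part negligible.\<close>

lemma grid_failure_bound:
  assumes i: "i \<in> {1..s}" and h: "0 < h" and n: "0 < n" and eta: "0 \<le> \<eta>"
    and small: "\<And>u l. 0 \<le> u \<Longrightarrow> u < h \<Longrightarrow> l \<in> {1..s} \<Longrightarrow> l \<noteq> i \<Longrightarrow> trans_prob u i l \<le> \<eta>"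
  shows "\<P>(\<omega> in P i. \<not> grid_avoids K (\<lambda>v. X v \<omega>) h n) \<le>
    real n * (entry_flow K (h / real n) i + \<eta> * (\<Sum>l\<in>{1..s}. entry_flow K (h / real n) l))"
proof -
  interpret Pi: prob_space "P i" using law_prob_space[OF i] .
  define d where "d = h / real n"
  have d: "0 \<le> d" using h by (simp add: d_def)
  define \<tau> where "\<tau> k = real k * h / real n" for k
  have \<tau>: "0 \<le> \<tau> k" "\<tau> (Suc k) = \<tau> k + d" for k
    using h by (simp_all add: \<tau>_def d_def add_divide_distrib distrib_right)
  have \<tau>_less: "\<tau> k < h" if "k < n" for k
    using that h n by (simp add: \<tau>_def pos_divide_less_eq mult.commute)
  define S where "S k l = {\<omega>\<in>space (P i). X (\<tau> k) \<omega> = l \<and> X (\<tau> k + d) \<omega> \<in> K \<inter> {1..s} - {l}}" for k l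
  define T where "T k l e = {\<omega>\<in>space (P i). X (\<tau> k) \<omega> = l \<and> X (\<tau> k + d) \<omega> = e}" for k l e
  have T: "T k l e \<in> sets (P i)" for k l e
    unfolding T_def using i d \<tau> by (intro sets.sets_Collect_conj X_event) auto
  have S_eq: "S k l = (\<Union>e\<in>K \<inter> {1..s} - {l}. T k l e)" for k l
    by (auto simp: S_def T_def)
  have S: "S k l \<in> sets (P i)" for k l
    unfolding S_eq using T by (intro sets.finite_UN) auto
  have mS: "measure (P i) (S k l) \<le> trans_prob (\<tau> k) i l * entry_flow K d l" for k l
  proof -
    have "measure (P i) (S k l) \<le> (\<Sum>e\<in>K \<inter> {1..s} - {l}. measure (P i) (T k l e))"
      unfolding S_eq using T by (intro Pi.finite_measure_subadditive_finite) auto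
    also have "\<dots> = trans_prob (\<tau> k) i l * entry_flow K d l"
      unfolding T_def entry_flow_def sum_distrib_left using trans_prob_step[OF i] d \<tau> by simp
    finally show ?thesis .
  qed
  have flow_nonneg: "0 \<le> entry_flow K d l" for l
    unfolding entry_flow_def by (intro sum_nonneg trans_prob_nonneg)
  have "{\<omega>\<in>space (P i). \<not> grid_avoids K (\<lambda>v. X v \<omega>) h n} \<subseteq> (\<Union>k\<in>{..<n}. \<Union>l\<in>{1..s}. S k l)"
  proof
    fix \<omega> assume "\<omega> \<in> {\<omega>\<in>space (P i). \<not> grid_avoids K (\<lambda>v. X v \<omega>) h n}"
    then obtain k where k: "k < n" "\<omega> \<in> space (P i)" "X (\<tau> (Suc k)) \<omega> \<in> K" "X (\<tau> k) \<omega> \<noteq> X (\<tau> (Suc k)) \<omega>"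
      unfolding grid_avoids_def \<tau>_def by blast
    have "X (\<tau> k) \<omega> \<in> {1..s}" "X (\<tau> (Suc k)) \<omega> \<in> {1..s}" using k i \<tau>(1) X_states by auto
    then have "\<omega> \<in> S k (X (\<tau> k) \<omega>)" using k by (simp add: S_def \<tau>)
    then show "\<omega> \<in> (\<Union>k\<in>{..<n}. \<Union>l\<in>{1..s}. S k l)" using k(1) \<open>X (\<tau> k) \<omega> \<in> {1..s}\<close> by blast
  qed
  then have "\<P>(\<omega> in P i. \<not> grid_avoids K (\<lambda>v. X v \<omega>) h n) \<le> measure (P i) (\<Union>k\<in>{..<n}. \<Union>l\<in>{1..s}. S k l)"
    using S by (intro Pi.finite_measure_mono sets.finite_UN) auto
  also have "\<dots> \<le> (\<Sum>k\<in>{..<n}. measure (P i) (\<Union>l\<in>{1..s}. S k l))"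
    using S by (intro Pi.finite_measure_subadditive_finite) auto
  also have "\<dots> \<le> (\<Sum>k\<in>{..<n}. \<Sum>l\<in>{1..s}. measure (P i) (S k l))"
    using S by (intro sum_mono Pi.finite_measure_subadditive_finite) auto
  also have "\<dots> \<le> (\<Sum>k\<in>{..<n}. \<Sum>l\<in>{1..s}. trans_prob (\<tau> k) i l * entry_flow K d l)"
    by (intro sum_mono mS)
  also have "\<dots> \<le> (\<Sum>k\<in>{..<n}. entry_flow K d i + \<eta> * (\<Sum>l\<in>{1..s}. entry_flow K d l))"
  proof (intro sum_mono)
    fix k assume "k \<in> {..<n}"
    then have k: "\<tau> k < h" using \<tau>_less by simp
    have "(\<Sum>l\<in>{1..s}. trans_prob (\<tau> k) i l * entry_flow K d l) =
        trans_prob (\<tau> k) i i * entry_flow K d i + (\<Sum>l\<in>{1..s} - {i}. trans_prob (\<tau> k) i l * entry_flow K d l)"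
      using i by (intro sum.remove) auto
    also have "trans_prob (\<tau> k) i i * entry_flow K d i \<le> 1 * entry_flow K d i"
      using flow_nonneg Pi.prob_le_1 by (intro mult_right_mono) (auto simp: trans_prob_def)
    also have "(\<Sum>l\<in>{1..s} - {i}. trans_prob (\<tau> k) i l * entry_flow K d l) \<le> (\<Sum>l\<in>{1..s} - {i}. \<eta> * entry_flow K d l)"
      using flow_nonneg small[OF \<tau>(1) k] by (intro sum_mono mult_right_mono) auto
    also have "\<dots> \<le> \<eta> * (\<Sum>l\<in>{1..s}. entry_flow K d l)"
      unfolding sum_distrib_left using eta flow_nonneg by (intro sum_mono2) auto
    finally show "(\<Sum>l\<in>{1..s}. trans_prob (\<tau> k) i l * entry_flow K d l) \<le>
        entry_flow K d i + \<eta> * (\<Sum>l\<in>{1..s}. entry_flow K d l)" by simp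
  qed
  also have "\<dots> = real n * (entry_flow K d i + \<eta> * (\<Sum>l\<in>{1..s}. entry_flow K d l))"
    by simp
  finally show ?thesis by (simp add: d_def)
qed

text \<open>As the grid is refined, \<open>n\<close> times the flow per step tends to \<open>h\<close> times the total rate into \<open>K\<close>. The events
  that all grids from the \<open>m\<close>-th on fail increase with \<open>m\<close> and exhaust the event of an entry.\<close>

lemma entry_prob_bound:
  assumes i: "i \<in> {1..s}" and h: "0 < h" and eta: "0 \<le> \<eta>"
    and small: "\<And>u l. 0 \<le> u \<Longrightarrow> u < h \<Longrightarrow> l \<in> {1..s} \<Longrightarrow> l \<noteq> i \<Longrightarrow> trans_prob u i l \<le> \<eta>"
  shows "1 - survival K h i \<le> h * ((\<Sum>e\<in>K \<inter> {1..s} - {i}. mat_entry Q i e) +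
    \<eta> * (\<Sum>l\<in>{1..s}. \<Sum>e\<in>K \<inter> {1..s} - {l}. mat_entry Q l e))" (is "_ \<le> ?L")
proof -
  interpret Pi: prob_space "P i" using law_prob_space[OF i] .
  define fail where "fail n = {\<omega>\<in>space (P i). \<not> grid_avoids K (\<lambda>v. X v \<omega>) h (Suc n)}" for n
  define bound where "bound n = real (Suc n) * (entry_flow K (h / real (Suc n)) i +
      \<eta> * (\<Sum>l\<in>{1..s}. entry_flow K (h / real (Suc n)) l))" for n
  have fail_set: "fail n \<in> sets (P i)" for n
    unfolding fail_def using h i by (intro sets.sets_Collect_neg grid_event X_measurable) auto
  have bound: "measure (P i) (fail n) \<le> bound n" for n
    unfolding fail_def bound_def by (intro grid_failure_bound i h eta small) auto
  have step: "filterlim (\<lambda>n. h / real (Suc n)) (at_right 0) sequentially"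
    using h by (intro tendsto_imp_filterlim_at_right tendsto_divide_0[OF tendsto_const]
      filterlim_at_top_imp_at_infinity filterlim_compose[OF filterlim_real_sequentially filterlim_Suc]) auto
  have flow: "(\<lambda>n. real (Suc n) * entry_flow K (h / real (Suc n)) l) \<longlonglongrightarrow> h * (\<Sum>e\<in>K \<inter> {1..s} - {l}. mat_entry Q l e)"
    if "l \<in> {1..s}" for l
  proof -
    have "(\<lambda>n. h * (entry_flow K (h / real (Suc n)) l / (h / real (Suc n)))) \<longlonglongrightarrow> h * (\<Sum>e\<in>K \<inter> {1..s} - {l}. mat_entry Q l e)"
      by (intro tendsto_mult tendsto_const filterlim_compose[OF entry_flow_rate[OF that] step])
    then show ?thesis using h by (simp add: mult.commute del: of_nat_Suc)
  qed
  have "(\<lambda>n. real (Suc n) * entry_flow K (h / real (Suc n)) i +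
      \<eta> * (\<Sum>l\<in>{1..s}. real (Suc n) * entry_flow K (h / real (Suc n)) l)) \<longlonglongrightarrow>
      h * (\<Sum>e\<in>K \<inter> {1..s} - {i}. mat_entry Q i e) + \<eta> * (\<Sum>l\<in>{1..s}. h * (\<Sum>e\<in>K \<inter> {1..s} - {l}. mat_entry Q l e))"
    by (intro tendsto_add tendsto_mult tendsto_const tendsto_sum flow i)
  then have lim: "bound \<longlonglongrightarrow> ?L"
    by (simp add: bound_def[abs_def] sum_distrib_left distrib_left mult_ac del: of_nat_Suc)
  define G where "G m = (\<Inter>n\<in>{m..}. fail n)" for m
  have G_set: "G m \<in> sets (P i)" for m
    unfolding G_def using fail_set by (intro sets.countable_INT') auto
  have "measure (P i) (G m) \<le> ?L" for m
  proof (rule LIMSEQ_le_const[OF lim], intro exI[of _ m] allI impI)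
    fix n assume "m \<le> n"
    then have "measure (P i) (G m) \<le> measure (P i) (fail n)"
      using fail_set by (intro Pi.finite_measure_mono) (auto simp: G_def)
    also have "\<dots> \<le> bound n" by (rule bound)
    finally show "measure (P i) (G m) \<le> bound n" .
  qed
  moreover have "(\<lambda>m. measure (P i) (G m)) \<longlonglongrightarrow> measure (P i) (\<Union>m. G m)"
    using G_set by (intro Pi.finite_Lim_measure_incseq) (auto simp: G_def incseq_def)
  ultimately have "measure (P i) (\<Union>m. G m) \<le> ?L"
    by (intro LIMSEQ_le_const2) auto
  moreover have "{\<omega>\<in>space (P i). \<not> avoids K (\<lambda>v. X v \<omega>) h} \<subseteq> (\<Union>m. G m)"
  proof
    fix \<omega> assume w: "\<omega> \<in> {\<omega>\<in>space (P i). \<not> avoids K (\<lambda>v. X v \<omega>) h}"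
    then have "right_const (\<lambda>v. X v \<omega>)" using right_const_path i by simp
    moreover have "\<not> avoids K (\<lambda>v. X v \<omega>) h" using w by simp
    ultimately have "\<exists>m. \<forall>n\<ge>m. 0 < n \<longrightarrow> \<not> grid_avoids K (\<lambda>v. X v \<omega>) h n"
      using h by (intro grid_detects_entry) auto
    then obtain m where "\<forall>n\<ge>m. 0 < n \<longrightarrow> \<not> grid_avoids K (\<lambda>v. X v \<omega>) h n" ..
    then have "\<omega> \<in> G m" using w by (auto simp: G_def fail_def)
    then show "\<omega> \<in> (\<Union>m. G m)" by blast
  qed
  then have "\<P>(\<omega> in P i. \<not> avoids K (\<lambda>v. X v \<omega>) h) \<le> measure (P i) (\<Union>m. G m)"
    using G_set by (intro Pi.finite_measure_mono) auto
  moreover have "\<P>(\<omega> in P i. \<not> avoids K (\<lambda>v. X v \<omega>) h) = 1 - survival K h i"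
    unfolding survival_def using avoids_event[OF i less_imp_le[OF h]] by (rule Pi.prob_neg)
  ultimately show ?thesis by simp
qed


lemma starts_at:
  assumes i: "i \<in> {1..s}"
  shows "AE \<omega> in P i. \<omega> \<in> space F \<and> X 0 \<omega> = i"
  using start[OF i] AE_space[of "P i"] by eventually_elim (use i in auto)

lemma entering_state_excluded:
  assumes i: "i \<in> {1..s}" and h: "0 < h" and j: "j \<in> K" "j \<noteq> i"
  shows "killed K h i j = 0"
proof -
  have "AE \<omega> in P i. \<not> (avoids K (\<lambda>v. X v \<omega>) h \<and> X h \<omega> = j)"
    using starts_at[OF i] by eventually_elim (use avoids_constD[of K "\<lambda>v. X v _" h 0 h] h j in auto)
  then show ?thesis
    unfolding killed_def using law_prob_space[OF i] by (simp add: prob_space.prob_eq_0_AE)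
qed

text \<open>The killed mass \<open>1 - survival\<close> is the sum over all states \<open>k\<close> of the deficits \<open>trans_prob - killed\<close>. The
  deficit of a state in \<open>K\<close> other than \<open>i\<close> is its whole transition probability, and these add up to the
  entry flow. What remains bounds the deficit of each other state.\<close>

lemma trans_prob_minus_killed_bound:
  assumes i: "i \<in> {1..s}" and h: "0 < h" and j: "j \<in> {1..s}" "j \<in> K \<longrightarrow> j = i"
  shows "trans_prob h i j - killed K h i j \<le> (1 - survival K h i) - entry_flow K h i"
proof -
  have nonneg: "0 \<le> trans_prob h i k - killed K h i k" if "k \<in> {1..s}" for k
    using killed_le_trans_prob[OF i, of h K k] h by simp
  have "trans_prob h i j - killed K h i j + entry_flow K h i =
      trans_prob h i j - killed K h i j + (\<Sum>e\<in>K \<inter> {1..s} - {i}. trans_prob h i e - killed K h i e)"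
    unfolding entry_flow_def using entering_state_excluded[OF i h] by simp
  also have "\<dots> = (\<Sum>k\<in>insert j (K \<inter> {1..s} - {i}). trans_prob h i k - killed K h i k)"
    using j by (subst sum.insert) auto
  also have "\<dots> \<le> (\<Sum>k\<in>{1..s}. trans_prob h i k - killed K h i k)"
    using j nonneg by (intro sum_mono2) auto
  also have "\<dots> = 1 - survival K h i"
    using trans_prob_row_sum[OF i, of h] survival_sum[OF i, of h K] h by (simp add: sum_subtractf)
  finally show ?thesis by simp
qed

text \<open>The bound on the killed mass and the entry flow agree to first order in \<open>h\<close>: surviving states lose
  only \<open>o(h)\<close>.\<close>

lemma trans_prob_minus_killed_rate:
  assumes i: "i \<in> {1..s}" and j: "j \<in> {1..s}" "j \<in> K \<longrightarrow> j = i"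
  shows "((\<lambda>h. (trans_prob h i j - killed K h i j) / h) \<longlongrightarrow> 0) (at_right 0)"
proof (rule tendstoI)
  fix \<epsilon> :: real assume "0 < \<epsilon>"
  define q where "q l = (\<Sum>e\<in>K \<inter> {1..s} - {l}. mat_entry Q l e)" for l
  have q: "0 \<le> q l" if "l \<in> {1..s}" for l
    unfolding q_def using that by (intro sum_nonneg rate_nonneg) auto
  define C where "C = (\<Sum>l\<in>{1..s}. q l)"
  have C: "0 \<le> C" unfolding C_def using q by (intro sum_nonneg) auto
  \<comment> \<open>Half of the tolerance is for \<open>\<eta> * C\<close>, the other half for the convergence of the flow.\<close>
  define \<eta> where "\<eta> = \<epsilon> / (2 * (C + 1))"
  have \<eta>: "0 < \<eta>" "\<eta> * C < \<epsilon> / 2"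
    using \<open>0 < \<epsilon>\<close> C by (auto simp: \<eta>_def field_simps)
  obtain b where b: "b > 0" "\<And>h l. 0 \<le> h \<Longrightarrow> h < b \<Longrightarrow> l \<in> {1..s} \<Longrightarrow> l \<noteq> i \<Longrightarrow> trans_prob h i l \<le> \<eta>"
    using trans_prob_small[OF i \<eta>(1)] by blast
  have "\<forall>\<^sub>F h in at_right 0. h \<in> {0<..<b}"
    using b(1) by (rule eventually_at_right_real)
  moreover have "\<forall>\<^sub>F h in at_right 0. q i - \<epsilon> / 2 < entry_flow K h i / h"
    using entry_flow_rate[OF i, of K] \<open>0 < \<epsilon>\<close> unfolding q_def by (intro order_tendstoD(1)) auto
  ultimately show "\<forall>\<^sub>F h in at_right 0. dist ((trans_prob h i j - killed K h i j) / h) 0 < \<epsilon>"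
  proof eventually_elim
    case (elim h)
    then have h: "0 < h" "h < b" by auto
    have "1 - survival K h i \<le> h * (q i + \<eta> * C)"
      unfolding q_def C_def using h b \<eta> by (intro entry_prob_bound i) auto
    with trans_prob_minus_killed_bound[OF i h(1) j]
    have "trans_prob h i j - killed K h i j \<le> h * (q i + \<eta> * C) - entry_flow K h i" by simp
    then have "(trans_prob h i j - killed K h i j) / h \<le> (h * (q i + \<eta> * C) - entry_flow K h i) / h"
      using h by (intro divide_right_mono) auto
    also have "\<dots> = q i + \<eta> * C - entry_flow K h i / h"
      using h by (simp add: diff_divide_distrib)
    finally have "(trans_prob h i j - killed K h i j) / h \<le> q i + \<eta> * C - entry_flow K h i / h" .
    moreover have "0 \<le> (trans_prob h i j - killed K h i j) / h"
      using h killed_le_trans_prob[OF i, of h K j] by simp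
    ultimately show ?case using elim \<eta> by (simp add: dist_real_def)
  qed
qed

text \<open>A state of \<open>K\<close> other than \<open>i\<close> can only be reached by an entry. On the other states the killed and the
  original chain agree to first order, so the given rates of the chain carry over.\<close>

theorem killed_generator:
  assumes i: "i \<in> {1..s}" and j: "j \<in> {1..s}"
  shows "((\<lambda>h. (killed K h i j - of_bool (i = j)) / h) \<longlongrightarrow> killed_rate K i j) (at_right 0)"
proof (cases "j \<in> K \<and> i \<noteq> j")
  case True
  then have "\<forall>\<^sub>F h in at_right 0. (killed K h i j - of_bool (i = j)) / h = 0"
    using entering_state_excluded[OF i, of _ j K] by (intro eventually_mono[OF eventually_at_right_less]) auto
  then show ?thesis using True by (simp add: killed_rate_def tendsto_eventually)
next
  case False
  have "((\<lambda>h. (trans_prob h i j - of_bool (i = j)) / h) \<longlongrightarrow> mat_entry Q i j) (at_right 0)"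
  proof (cases "i = j")
    case False
    then show ?thesis using transition_rate[OF i j] by (simp add: trans_prob_def)
  next
    case True
    have "((\<lambda>h. - (\<Sum>l\<in>{1..s} - {i}. trans_prob h i l / h)) \<longlongrightarrow> - (\<Sum>l\<in>{1..s} - {i}. mat_entry Q i l)) (at_right 0)"
      unfolding trans_prob_def using i by (intro tendsto_minus tendsto_sum transition_rate) auto
    moreover have "\<forall>\<^sub>F h in at_right 0. - (\<Sum>l\<in>{1..s} - {i}. trans_prob h i l / h) = (trans_prob h i j - of_bool (i = j)) / h"
      using eventually_at_right_less[of "0::real"]
    proof eventually_elim
      case (elim h)
      have "1 = trans_prob h i i + (\<Sum>l\<in>{1..s} - {i}. trans_prob h i l)"
        using trans_prob_row_sum[OF i, of h] elim i by (simp add: sum.remove)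
      then show ?case using True by (simp add: sum_divide_distrib[symmetric] minus_divide_left del: minus_divide_left[symmetric])
    qed
    ultimately show ?thesis using True rate_diag[OF i] by (simp add: Lim_transform_eventually)
  qed
  from tendsto_diff[OF this trans_prob_minus_killed_rate[OF i j, of K]] False
  show ?thesis by (auto simp: killed_rate_def diff_divide_distrib)
qed

end

section \<open>The Green function of the killed chain\<close>

context markov_chain
begin

text \<open>Approximate \<open>t\<close> from the right by multiples of \<open>1/(n+1)\<close>; by right-continuity the approximating states
  are eventually exact. The maximum with \<open>0\<close> is there because nothing is known about negative times.\<close>

lemma X_jointly_measurable:
  assumes i: "i \<in> {1..s}"
  shows "(\<lambda>x. X (max 0 (fst x)) (snd x)) \<in> lborel \<Otimes>\<^sub>M P i \<rightarrow>\<^sub>M count_space UNIV"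
proof -
  let ?M = "(lborel :: real measure) \<Otimes>\<^sub>M P i"
  define m where "m n t = nat \<lfloor>real (Suc n) * max 0 t\<rfloor>" for n :: nat and t :: real
  define a where "a n t = (real (m n t) + 1) / real (Suc n)" for n :: nat and t :: real
  have a: "max 0 t < a n t" "a n t \<le> max 0 t + 1 / real (Suc n)" for t n
  proof -
    \<comment> \<open>Abbreviating the maximum keeps the simplifier from splitting it.\<close>
    define c where "c = max 0 t"
    have m: "real (m n t) \<le> real (Suc n) * c" "real (Suc n) * c < real (m n t) + 1"
      unfolding m_def c_def by (auto simp: of_nat_nat simp del: of_nat_Suc)
    have "c < a n t"
      using m(2) by (simp add: a_def pos_less_divide_eq mult.commute del: of_nat_Suc)
    then show "max 0 t < a n t" by (simp add: c_def)
    have "a n t \<le> (real (Suc n) * c + 1) / real (Suc n)"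
      unfolding a_def using m(1) by (intro divide_right_mono) auto
    then show "a n t \<le> max 0 t + 1 / real (Suc n)"
      unfolding c_def[symmetric] by (simp add: add_divide_distrib del: of_nat_Suc)
  qed
  have approx: "(\<lambda>x. X (a n (fst x)) (snd x)) \<in> ?M \<rightarrow>\<^sub>M count_space UNIV" for n
  proof -
    have index: "(\<lambda>x. m n (fst x)) \<in> ?M \<rightarrow>\<^sub>M count_space UNIV"
      unfolding m_def by measurable
    have at_index: "(\<lambda>x. X ((real k + 1) / real (Suc n)) (snd x)) \<in> ?M \<rightarrow>\<^sub>M count_space UNIV" for k
      by (rule measurable_compose[OF measurable_snd X_measurable[OF i]]) simp
    show ?thesis
      unfolding a_def by (rule measurable_compose_countable[OF at_index index])
  qed
  have eventually_exact: "\<exists>N. \<forall>n\<ge>N. X (a n t) \<omega> = X (max 0 t) \<omega>" if w: "\<omega> \<in> space F" for t \<omega>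
  proof -
    obtain d where d: "d > 0" "\<And>u. max 0 t \<le> u \<Longrightarrow> u < max 0 t + d \<Longrightarrow> X u \<omega> = X (max 0 t) \<omega>"
      using right_const_path[OF w] unfolding right_const_def by (meson max.cobounded1)
    obtain N where N: "1 / real (Suc N) < d" using d(1) nat_approx_posE by blast
    show ?thesis
    proof (intro exI[of _ N] allI impI d(2))
      fix n assume "N \<le> n"
      then have "1 / real (Suc n) \<le> 1 / real (Suc N)" by (simp add: frac_le)
      then show "max 0 t \<le> a n t" "a n t < max 0 t + d" using a(1)[of t n] a(2)[of n t] N by auto
    qed
  qed
  show ?thesis
  proof (subst measurable_count_space_eq2_countable, safe)
    fix k :: nat
    have "{x\<in>space ?M. \<exists>N. \<forall>n\<in>{N..}. X (a n (fst x)) (snd x) = k} \<in> sets ?M"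
      by (intro sets.sets_Collect_countable_Ex sets.sets_Collect_countable_Ball
          measurable_sets_Collect[OF approx]) auto
    also have "{x\<in>space ?M. \<exists>N. \<forall>n\<in>{N..}. X (a n (fst x)) (snd x) = k} =
        (\<lambda>x. X (max 0 (fst x)) (snd x)) -` {k} \<inter> space ?M"
    proof (rule Set.set_eqI)
      fix x
      show "x \<in> {x\<in>space ?M. \<exists>N. \<forall>n\<in>{N..}. X (a n (fst x)) (snd x) = k} \<longleftrightarrow>
        x \<in> (\<lambda>x. X (max 0 (fst x)) (snd x)) -` {k} \<inter> space ?M"
      proof (cases "x \<in> space ?M")
        case True
        then have "snd x \<in> space F" using i by (auto simp: space_pair_measure)
        from eventually_exact[OF this, of "fst x"] obtain N where
          N: "\<And>n. n \<ge> N \<Longrightarrow> X (a n (fst x)) (snd x) = X (max 0 (fst x)) (snd x)" by blast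
        have "(\<exists>N. \<forall>n\<ge>N. X (a n (fst x)) (snd x) = k) \<longleftrightarrow> X (max 0 (fst x)) (snd x) = k"
          using N by (metis nle_le)
        then show ?thesis using True by (simp add: Ball_def)
      qed simp
    qed
    finally show "(\<lambda>x. X (max 0 (fst x)) (snd x)) -` {k} \<inter> space ?M \<in> sets ?M" .
  qed auto
qed

definition alive_at :: "nat set \<Rightarrow> nat \<Rightarrow> nat \<Rightarrow> (real \<times> 'w) set" where
  "alive_at K i j = {x. 0 \<le> fst x \<and> snd x \<in> space (P i) \<and>
     avoids K (\<lambda>v. X v (snd x)) (fst x) \<and> X (fst x) (snd x) = j}"

text \<open>Rescaling the time axis by \<open>t\<close> turns the grids on \<open>[0, t]\<close>, which vary with \<open>t\<close>, into grids on \<open>[0, 1]\<close>.\<close>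

lemma alive_at_measurable:
  assumes i: "i \<in> {1..s}"
  shows "alive_at K i j \<in> sets ((lborel :: real measure) \<Otimes>\<^sub>M P i)"
proof -
  let ?M = "(lborel :: real measure) \<Otimes>\<^sub>M P i"
  define Y where "Y x v = X (max 0 (v * fst x)) (snd x)" for x v
  have Y: "(\<lambda>x. Y x v) \<in> ?M \<rightarrow>\<^sub>M count_space UNIV" for v
  proof -
    have "(\<lambda>x. (v * fst x, snd x)) \<in> ?M \<rightarrow>\<^sub>M ?M" by measurable
    from measurable_compose[OF this X_jointly_measurable[OF i]] show ?thesis
      by (simp add: Y_def)
  qed
  have "{x\<in>space ?M. \<forall>n\<in>{0<..}. grid_avoids K (Y x) 1 n} \<in> sets ?M"
    using Y by (intro sets.sets_Collect_countable_Ball grid_event) auto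
  moreover have "{x\<in>space ?M. Y x 1 = j} \<in> sets ?M"
    by (rule measurable_sets_Collect[OF Y]) auto
  moreover have "{x\<in>space ?M. 0 \<le> fst x} \<in> sets ?M"
  proof -
    have "fst -` {0::real..} \<inter> space ?M \<in> sets ?M"
      by (rule measurable_sets[OF measurable_fst]) simp
    also have "fst -` {0::real..} \<inter> space ?M = {x\<in>space ?M. 0 \<le> fst x}" by auto
    finally show ?thesis .
  qed
  ultimately have "{x\<in>space ?M. (\<forall>n\<in>{0<..}. grid_avoids K (Y x) 1 n) \<and> Y x 1 = j \<and> 0 \<le> fst x} \<in> sets ?M"
    by (intro sets.sets_Collect_conj)
  also have "{x\<in>space ?M. (\<forall>n\<in>{0<..}. grid_avoids K (Y x) 1 n) \<and> Y x 1 = j \<and> 0 \<le> fst x} = alive_at K i j"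
  proof (rule Set.set_eqI)
    fix x
    have "(\<forall>n\<in>{0<..}. grid_avoids K (Y x) 1 n) \<longleftrightarrow> avoids K (\<lambda>v. X v (snd x)) (fst x)"
      if "0 \<le> fst x" "snd x \<in> space (P i)"
    proof -
      have "grid_avoids K (Y x) 1 n = grid_avoids K (\<lambda>v. X v (snd x)) (fst x) n" for n
        using that(1) by (simp add: grid_avoids_def Y_def del: of_nat_Suc)
      then show ?thesis using avoids_iff_grid[OF right_const_path that(1), of "snd x" K] that(2) i by auto
    qed
    then show "x \<in> {x\<in>space ?M. (\<forall>n\<in>{0<..}. grid_avoids K (Y x) 1 n) \<and> Y x 1 = j \<and> 0 \<le> fst x} \<longleftrightarrow>
        x \<in> alive_at K i j"
      by (cases x) (auto simp: alive_at_def space_pair_measure Y_def)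
  qed
  finally show ?thesis .
qed

definition green :: "nat set \<Rightarrow> nat \<Rightarrow> nat \<Rightarrow> ennreal" where
  "green K i j = (\<integral>\<^sup>+t\<in>{0..}. ennreal (killed K t i j) \<partial>lborel)"

lemma killed_measurable:
  assumes i: "i \<in> {1..s}"
  shows "(\<lambda>t. ennreal (killed K t i j) * indicator {0..} t) \<in> borel_measurable borel"
proof -
  interpret Pi: prob_space "P i" using law_prob_space[OF i] .
  have "(\<lambda>t. emeasure (P i) (Pair t -` alive_at K i j)) \<in> borel_measurable lborel"
    by (rule Pi.measurable_emeasure_Pair[OF alive_at_measurable[OF i]])
  also have "(\<lambda>t. emeasure (P i) (Pair t -` alive_at K i j)) = (\<lambda>t. ennreal (killed K t i j) * indicator {0..} t)"
  proof
    fix t :: real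
    have "Pair t -` alive_at K i j =
        (if 0 \<le> t then {\<omega>\<in>space (P i). avoids K (\<lambda>v. X v \<omega>) t \<and> X t \<omega> = j} else {})"
      by (auto simp: alive_at_def)
    then show "emeasure (P i) (Pair t -` alive_at K i j) = ennreal (killed K t i j) * indicator {0..} t"
      by (simp add: killed_def Pi.emeasure_eq_measure)
  qed
  finally show ?thesis by simp
qed

lemma survival_antimono:
  assumes i: "i \<in> {1..s}" and t: "0 \<le> t" "t \<le> t'"
  shows "survival K t' i \<le> survival K t i"
  unfolding survival_def
  using t by (intro finite_measure.finite_measure_mono law_finite_measure i avoids_event) (auto intro: avoids_mono)

text \<open>Reaching \<open>e\<close> from another state requires an entry into \<open>K\<close>.\<close>

lemma survival_less_1:
  assumes irr: "irreducible_chain s P X" and i: "i \<in> {1..s}" and e: "e \<in> K \<inter> {1..s}" "e \<noteq> i"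
  shows "\<exists>t>0. survival K t i < 1"
proof -
  obtain t where t: "0 \<le> t" "0 < \<P>(\<omega> in P i. X t \<omega> = e)"
    using irr i e unfolding irreducible_chain_def by blast
  then have "t \<noteq> 0" using trans_prob_zero[OF i e(2)] by (auto simp: trans_prob_def)
  then have pos: "0 < t" using t by simp
  have "trans_prob t i e \<le> 1 - survival K t i"
  proof -
    have "entry_flow K t i \<ge> trans_prob t i e"
      unfolding entry_flow_def using e trans_prob_nonneg by (intro member_le_sum) auto
    moreover have "entry_flow K t i \<le> 1 - survival K t i"
      using trans_prob_minus_killed_bound[OF i pos i, where K = K] killed_le_trans_prob[OF i t(1), of K i] by simp
    ultimately show ?thesis by simp
  qed
  then show ?thesis using t pos by (auto simp: trans_prob_def)
qed

lemma survival_geometric: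
  assumes irr: "irreducible_chain s P X" and K: "\<And>i. i \<in> {1..s} \<Longrightarrow> \<exists>e\<in>K \<inter> {1..s}. e \<noteq> i"
  shows "\<exists>t0>0. \<exists>\<rho>. 0 \<le> \<rho> \<and> \<rho> < 1 \<and> (\<forall>m. \<forall>i\<in>{1..s}. survival K (real m * t0) i \<le> \<rho> ^ m)"
proof -
  have "\<exists>t>0. survival K t i < 1" if "i \<in> {1..s}" for i
    using K[OF that] survival_less_1[OF irr that] by blast
  then obtain T where T: "\<And>i. i \<in> {1..s} \<Longrightarrow> T i > 0 \<and> survival K (T i) i < 1"
    by metis
  define t0 where "t0 = Max (insert 1 (T ` {1..s}))"
  define \<rho> where "\<rho> = Max (insert 0 (survival K t0 ` {1..s}))"
  have t0: "T i \<le> t0" if "i \<in> {1..s}" for i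
    unfolding t0_def using that by (intro Max_ge) auto
  have t0_pos: "0 < t0" by (simp add: t0_def Max_gr_iff)
  have "survival K t0 i < 1" if "i \<in> {1..s}" for i
    using survival_antimono[OF that _ t0[OF that], of K] T[OF that] by simp
  then have "\<rho> < 1" unfolding \<rho>_def by (subst Max_less_iff) auto
  moreover have "0 \<le> \<rho>" "\<And>i. i \<in> {1..s} \<Longrightarrow> survival K t0 i \<le> \<rho>"
    unfolding \<rho>_def by (rule Max_ge; simp)+
  ultimately have \<rho>: "0 \<le> \<rho>" "\<rho> < 1" "\<And>i. i \<in> {1..s} \<Longrightarrow> survival K t0 i \<le> \<rho>" by auto
  have "survival K (real m * t0) i \<le> \<rho> ^ m" if "i \<in> {1..s}" for m i
    using that
  proof (induction m arbitrary: i)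
    case 0
    then show ?case using survival_le_1 by simp
  next
    case (Suc m)
    have "survival K (real (Suc m) * t0) i = survival K (t0 + real m * t0) i"
      by (simp add: algebra_simps)
    also have "\<dots> = (\<Sum>k\<in>{1..s}. killed K t0 i k * survival K (real m * t0) k)"
      using t0_pos Suc by (intro survival_add) auto
    also have "\<dots> \<le> (\<Sum>k\<in>{1..s}. killed K t0 i k * \<rho> ^ m)"
      using Suc killed_nonneg by (intro sum_mono mult_left_mono) auto
    also have "\<dots> = survival K t0 i * \<rho> ^ m"
      using survival_sum[OF Suc.prems, of t0 K] t0_pos by (simp add: sum_distrib_right)
    also have "\<dots> \<le> \<rho> * \<rho> ^ m"
      using \<rho> Suc.prems by (intro mult_right_mono) auto
    finally show ?case by simp
  qed
  then show ?thesis using t0_pos \<rho> by blast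
qed

text \<open>Bound the killed transition probability on each cell of length \<open>t0\<close> by a term of a geometric series.\<close>

lemma green_finite:
  assumes irr: "irreducible_chain s P X" and K: "\<And>i. i \<in> {1..s} \<Longrightarrow> \<exists>e\<in>K \<inter> {1..s}. e \<noteq> i"
    and i: "i \<in> {1..s}" and j: "j \<in> {1..s}"
  shows "green K i j < \<infinity>"
proof -
  obtain t0 \<rho> where t0: "t0 > 0" and \<rho>: "0 \<le> \<rho>" "\<rho> < 1"
    and decay: "\<And>m i. i \<in> {1..s} \<Longrightarrow> survival K (real m * t0) i \<le> \<rho> ^ m"
    using survival_geometric[OF irr K] by blast
  define cell where "cell m = {real m * t0..<real m * t0 + t0}" for m
  define g where "g m t = ennreal (\<rho> ^ m) * indicator (cell m) t" for m t
  have "ennreal (killed K t i j) * indicator {0..} t \<le> (\<Sum>m. g m t)" for t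
  proof (cases "0 \<le> t")
    case True
    \<comment> \<open>the cell that contains \<open>t\<close>\<close>
    define m where "m = nat \<lfloor>t / t0\<rfloor>"
    have "real m \<le> t / t0" "t / t0 < real m + 1"
      using True t0 by (auto simp: m_def of_nat_nat)
    then have m: "real m * t0 \<le> t" "t < real m * t0 + t0"
      using t0 by (auto simp: field_simps)
    have "killed K t i j \<le> survival K t i"
      using survival_sum[OF i True] j killed_nonneg by (simp add: member_le_sum)
    also have "\<dots> \<le> survival K (real m * t0) i"
      using m t0 by (intro survival_antimono i) auto
    also have "\<dots> \<le> \<rho> ^ m" by (rule decay[OF i])
    finally have "ennreal (killed K t i j) * indicator {0..} t \<le> ennreal (\<rho> ^ m) * indicator (cell m) t"
      using True m by (simp add: cell_def ennreal_leI)
    also have "\<dots> \<le> (\<Sum>m. g m t)"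
      unfolding g_def[symmetric] using sum_le_suminf[of "\<lambda>m. g m t" "{m}"] by simp
    finally show ?thesis .
  qed simp
  then have "green K i j \<le> (\<integral>\<^sup>+t. (\<Sum>m. g m t) \<partial>lborel)"
    unfolding green_def by (intro nn_integral_mono) auto
  also have "\<dots> = (\<Sum>m. \<integral>\<^sup>+t. g m t \<partial>lborel)"
    by (intro nn_integral_suminf) (simp add: g_def cell_def)
  also have "\<dots> = (\<Sum>m. ennreal (\<rho> ^ m * t0))"
    using t0 \<rho> by (intro suminf_cong) (simp add: g_def cell_def nn_integral_cmult_indicator ennreal_mult)
  also have "\<dots> < \<infinity>"
    using \<rho> t0 by (simp add: less_top[symmetric]) (intro ennreal_suminf_neq_top summable_mult2 summable_geometric; simp)
  finally show ?thesis .
qed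

text \<open>The semigroup property under the integral over \<open>t \<ge> h\<close>.\<close>

lemma green_renewal:
  assumes i: "i \<in> {1..s}" and h: "0 \<le> h"
  shows "green K i j = (\<integral>\<^sup>+t\<in>{0..<h}. ennreal (killed K t i j) \<partial>lborel) +
    (\<Sum>k\<in>{1..s}. ennreal (killed K h i k) * green K k j)"
proof -
  define f where "f k t = ennreal (killed K t k j) * indicator {0..} t" for k t
  have f [measurable]: "f k \<in> borel_measurable borel" if "k \<in> {1..s}" for k
    unfolding f_def by (rule killed_measurable[OF that])
  note [measurable] = f[OF i]
  have "green K i j = (\<integral>\<^sup>+t. f i t * indicator {0..<h} t + f i t * indicator {h..} t \<partial>lborel)"
    unfolding green_def f_def using h by (intro nn_integral_cong) (auto simp: indicator_def)
  also have "\<dots> = (\<integral>\<^sup>+t. f i t * indicator {0..<h} t \<partial>lborel) + (\<integral>\<^sup>+t. f i t * indicator {h..} t \<partial>lborel)"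
    by (intro nn_integral_add) auto
  also have "(\<integral>\<^sup>+t. f i t * indicator {0..<h} t \<partial>lborel) = (\<integral>\<^sup>+t\<in>{0..<h}. ennreal (killed K t i j) \<partial>lborel)"
    unfolding f_def by (intro nn_integral_cong) (auto simp: indicator_def)
  also have "(\<integral>\<^sup>+t. f i t * indicator {h..} t \<partial>lborel) = (\<integral>\<^sup>+t. f i (h + t) * indicator {h..} (h + t) \<partial>lborel)"
    using nn_integral_real_affine[of "\<lambda>t. f i t * indicator {h..} t" 1 h] by simp
  also have "\<dots> = (\<integral>\<^sup>+t. (\<Sum>k\<in>{1..s}. ennreal (killed K h i k) * f k t) \<partial>lborel)"
  proof (intro nn_integral_cong)
    fix t :: real
    show "f i (h + t) * indicator {h..} (h + t) = (\<Sum>k\<in>{1..s}. ennreal (killed K h i k) * f k t)"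
    proof (cases "0 \<le> t")
      case True
      then have "f i (h + t) * indicator {h..} (h + t) = ennreal (\<Sum>k\<in>{1..s}. killed K h i k * killed K t k j)"
        using h killed_semigroup[OF i h True] by (simp add: f_def)
      also have "\<dots> = (\<Sum>k\<in>{1..s}. ennreal (killed K h i k * killed K t k j))"
        using killed_nonneg by (intro sum_ennreal[symmetric]) auto
      also have "\<dots> = (\<Sum>k\<in>{1..s}. ennreal (killed K h i k) * f k t)"
        using True killed_nonneg by (intro sum.cong refl) (simp add: f_def ennreal_mult)
      finally show ?thesis .
    qed (simp add: f_def)
  qed
  also have "\<dots> = (\<Sum>k\<in>{1..s}. \<integral>\<^sup>+t. ennreal (killed K h i k) * f k t \<partial>lborel)"
    using f by (intro nn_integral_sum) auto
  also have "\<dots> = (\<Sum>k\<in>{1..s}. ennreal (killed K h i k) * green K k j)"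
    unfolding green_def f_def[symmetric] using f by (intro sum.cong refl nn_integral_cmult) auto
  finally show ?thesis by blast
qed

end

section \<open>The Green function inverts the generator, and measures the occupation times\<close>

context markov_chain
begin

lemma killed_at_0:
  assumes i: "i \<in> {1..s}"
  shows "killed K 0 i j = of_bool (i = j)"
proof -
  have "killed K 0 i j = trans_prob 0 i j"
    unfolding killed_def trans_prob_def by (auto simp: avoids_def entries_def intro!: arg_cong[where f = "measure (P i)"])
  moreover have "trans_prob 0 i i = 1"
    using trans_prob_row_sum[OF i, of 0] trans_prob_zero[OF i] i by (simp add: sum.remove[of _ i])
  ultimately show ?thesis using trans_prob_zero[OF i, of j] by auto
qed

lemma killed_near_0:
  assumes i: "i \<in> {1..s}" and j: "j \<in> {1..s}" and "\<epsilon> > 0"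
  shows "\<exists>b>0. \<forall>t. 0 \<le> t \<longrightarrow> t < b \<longrightarrow> \<bar>killed K t i j - of_bool (i = j)\<bar> \<le> \<epsilon>"
proof -
  have "((\<lambda>h. (killed K h i j - of_bool (i = j)) / h * h) \<longlongrightarrow> killed_rate K i j * 0) (at_right 0)"
    by (intro tendsto_mult killed_generator i j tendsto_ident_at)
  then have "\<forall>\<^sub>F h in at_right 0. dist ((killed K h i j - of_bool (i = j)) / h * h) 0 < \<epsilon>"
    using \<open>\<epsilon> > 0\<close> by (intro tendstoD) auto
  then have "\<forall>\<^sub>F h in at_right 0. \<bar>killed K h i j - of_bool (i = j)\<bar> < \<epsilon>"
    using eventually_at_right_less[of "0::real"] by eventually_elim (simp add: dist_real_def)
  then obtain b where b: "b > 0" "\<And>h. 0 < h \<Longrightarrow> h < b \<Longrightarrow> \<bar>killed K h i j - of_bool (i = j)\<bar> < \<epsilon>"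
    unfolding eventually_at_right_field by blast
  have "\<bar>killed K t i j - of_bool (i = j)\<bar> \<le> \<epsilon>" if "0 \<le> t" "t < b" for t
    using b(2)[of t] killed_at_0[OF i, of K j] that \<open>\<epsilon> > 0\<close> by (cases "t = 0") auto
  with b(1) show ?thesis by blast
qed

lemma killed_mean_near_0:
  assumes i: "i \<in> {1..s}" and j: "j \<in> {1..s}"
  shows "((\<lambda>h. enn2real (\<integral>\<^sup>+t\<in>{0..<h}. ennreal (killed K t i j) \<partial>lborel) / h) \<longlongrightarrow> of_bool (i = j)) (at_right 0)"
proof (rule tendstoI)
  fix \<epsilon> :: real assume "0 < \<epsilon>"
  define \<delta> :: real where "\<delta> = of_bool (i = j)"
  obtain b where b: "b > 0" "\<And>t. 0 \<le> t \<Longrightarrow> t < b \<Longrightarrow> \<bar>killed K t i j - \<delta>\<bar> \<le> \<epsilon> / 2"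
    using killed_near_0[OF i j, of "\<epsilon> / 2" K] \<open>0 < \<epsilon>\<close> unfolding \<delta>_def by auto
  have "\<forall>\<^sub>F h in at_right 0. h \<in> {0<..<b}"
    using b(1) by (rule eventually_at_right_real)
  then show "\<forall>\<^sub>F h in at_right 0. dist (enn2real (\<integral>\<^sup>+t\<in>{0..<h}. ennreal (killed K t i j) \<partial>lborel) / h) (of_bool (i = j)) < \<epsilon>"
  proof eventually_elim
    case (elim h)
    then have h: "0 < h" "h < b" by auto
    let ?I = "\<integral>\<^sup>+t\<in>{0..<h}. ennreal (killed K t i j) \<partial>lborel"
    have const: "(\<integral>\<^sup>+t\<in>{0..<h}. ennreal c \<partial>lborel) = ennreal (max 0 c * h)" for c
      using h by (simp add: nn_integral_cmult_indicator ennreal_mult max_def ennreal_neg)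
    have near: "killed K t i j \<le> \<delta> + \<epsilon> / 2" "\<delta> - \<epsilon> / 2 \<le> killed K t i j" if "t \<in> {0..<h}" for t
    proof -
      have "\<bar>killed K t i j - \<delta>\<bar> \<le> \<epsilon> / 2" using b(2)[of t] h that by simp
      then show "killed K t i j \<le> \<delta> + \<epsilon> / 2" "\<delta> - \<epsilon> / 2 \<le> killed K t i j" by linarith+
    qed
    have "?I \<le> (\<integral>\<^sup>+t\<in>{0..<h}. ennreal (\<delta> + \<epsilon> / 2) \<partial>lborel)"
      using near by (intro nn_integral_mono) (simp add: indicator_def ennreal_leI)
    then have upper: "?I \<le> ennreal (max 0 (\<delta> + \<epsilon> / 2) * h)" by (simp add: const)
    have "(\<integral>\<^sup>+t\<in>{0..<h}. ennreal (\<delta> - \<epsilon> / 2) \<partial>lborel) \<le> ?I"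
      using near by (intro nn_integral_mono) (simp add: indicator_def ennreal_leI)
    then have lower: "ennreal (max 0 (\<delta> - \<epsilon> / 2) * h) \<le> ?I" by (simp add: const)
    obtain I where I: "?I = ennreal I" "0 \<le> I"
      using upper by (cases ?I) (auto simp: top_unique)
    have "I \<le> (\<delta> + \<epsilon> / 2) * h" "(\<delta> - \<epsilon> / 2) * h \<le> I"
    proof -
      have "0 \<le> \<delta>" by (simp add: \<delta>_def)
      then show "I \<le> (\<delta> + \<epsilon> / 2) * h"
        using upper I \<open>0 < \<epsilon>\<close> h by (simp add: max_def)
      have "(\<delta> - \<epsilon> / 2) * h \<le> max 0 (\<delta> - \<epsilon> / 2) * h" using h by (intro mult_right_mono) auto
      also have "\<dots> \<le> I" using lower I by simp
      finally show "(\<delta> - \<epsilon> / 2) * h \<le> I" .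
    qed
    then have "I / h \<le> \<delta> + \<epsilon> / 2" "\<delta> - \<epsilon> / 2 \<le> I / h"
      using h by (simp_all add: pos_divide_le_eq pos_le_divide_eq)
    then show ?case using I \<open>0 < \<epsilon>\<close> by (simp add: \<delta>_def[symmetric] dist_real_def)
  qed
qed

text \<open>Divide the renewal equation by \<open>h\<close> and let \<open>h\<close> tend to \<open>0\<close>: the difference quotient of the semigroup tends
  to its generator, and the mean of the semigroup over \<open>[0, h)\<close> to the identity.\<close>

theorem green_right_inverse:
  assumes fin: "\<And>k. k \<in> {1..s} \<Longrightarrow> green K k j < \<infinity>"
    and i: "i \<in> {1..s}" and j: "j \<in> {1..s}"
  shows "(\<Sum>k\<in>{1..s}. killed_rate K i k * enn2real (green K k j)) = - of_bool (i = j)"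
proof -
  define g where "g k = enn2real (green K k j)" for k
  have g: "green K k j = ennreal (g k)" "0 \<le> g k" if "k \<in> {1..s}" for k
    using fin[OF that] by (auto simp: g_def)
  define I where "I h = enn2real (\<integral>\<^sup>+t\<in>{0..<h}. ennreal (killed K t i j) \<partial>lborel)" for h
  have renewal: "I h = g i - (\<Sum>k\<in>{1..s}. killed K h i k * g k)" if "0 \<le> h" for h
  proof -
    let ?J = "\<integral>\<^sup>+t\<in>{0..<h}. ennreal (killed K t i j) \<partial>lborel"
    have "(\<Sum>k\<in>{1..s}. ennreal (killed K h i k) * green K k j) = (\<Sum>k\<in>{1..s}. ennreal (killed K h i k * g k))"
      using g killed_nonneg by (intro sum.cong refl) (simp add: ennreal_mult)
    also have "\<dots> = ennreal (\<Sum>k\<in>{1..s}. killed K h i k * g k)"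
      using g killed_nonneg by (intro sum_ennreal) auto
    finally have eq: "ennreal (g i) = ?J + ennreal (\<Sum>k\<in>{1..s}. killed K h i k * g k)"
      using green_renewal[OF i that, of K j] g(1)[OF i] by simp
    then have "?J \<noteq> \<infinity>" by (metis ennreal_neq_top ennreal_add_eq_top infinity_ennreal_def)
    then have J: "?J = ennreal (I h)" "0 \<le> I h" by (auto simp: I_def less_top)
    have "0 \<le> (\<Sum>k\<in>{1..s}. killed K h i k * g k)"
      using g killed_nonneg by (intro sum_nonneg mult_nonneg_nonneg) auto
    with eq J g(2)[OF i] have "g i = I h + (\<Sum>k\<in>{1..s}. killed K h i k * g k)"
      by (simp flip: ennreal_plus)
    then show ?thesis by simp
  qed
  have "((\<lambda>h. - (\<Sum>k\<in>{1..s}. (killed K h i k - of_bool (i = k)) / h * g k)) \<longlongrightarrow>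
      - (\<Sum>k\<in>{1..s}. killed_rate K i k * g k)) (at_right 0)"
    by (intro tendsto_minus tendsto_sum tendsto_mult tendsto_const killed_generator i)
  moreover have "\<forall>\<^sub>F h in at_right 0. - (\<Sum>k\<in>{1..s}. (killed K h i k - of_bool (i = k)) / h * g k) = I h / h"
    using eventually_at_right_less[of "0::real"]
  proof eventually_elim
    case (elim h)
    have "(\<Sum>k\<in>{1..s}. (killed K h i k - of_bool (i = k)) / h * g k) =
        ((\<Sum>k\<in>{1..s}. killed K h i k * g k) - (\<Sum>k\<in>{1..s}. of_bool (i = k) * g k)) / h"
      by (simp only: sum_divide_distrib sum_subtractf[symmetric] times_divide_eq_left left_diff_distrib)
    also have "(\<Sum>k\<in>{1..s}. of_bool (i = k) * g k) = g i"
      using i by (simp add: of_bool_def if_distrib[where f = "\<lambda>x. x * _"] cong: if_cong)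
    finally show ?case using renewal[of h] elim by (simp add: diff_divide_distrib)
  qed
  ultimately have "((\<lambda>h. I h / h) \<longlongrightarrow> - (\<Sum>k\<in>{1..s}. killed_rate K i k * g k)) (at_right 0)"
    by (rule Lim_transform_eventually)
  moreover have "((\<lambda>h. I h / h) \<longlongrightarrow> of_bool (i = j)) (at_right 0)"
    unfolding I_def by (rule killed_mean_near_0[OF i j])
  ultimately have "- (\<Sum>k\<in>{1..s}. killed_rate K i k * g k) = of_bool (i = j)"
    by (rule tendsto_unique[OF trivial_limit_at_right_real])
  then show ?thesis by (simp add: g_def)
qed

lemma sigma_less_iff_path:
  assumes "\<omega> \<in> space F" "e \<noteq> e'"
  shows "sigma X e \<omega> < sigma X e' \<omega> \<longleftrightarrow> (\<lambda>v. X v \<omega>) \<in> enters_before_paths e e'"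
  using sigma_less_iff[where X = X and \<omega> = \<omega>, OF right_const_path[OF assms(1)] assms(2)]
    enters_before_paths_iff[OF right_const_path[OF assms(1)] assms(2)] by simp

lemma hit_event_eq:
  assumes i: "i \<in> {1..s}" and "e \<in> {1, 2}"
  shows "{\<omega>\<in>space (P i). sigma X e \<omega> < sigma X (3 - e) \<omega>} =
    {\<omega>\<in>space (P i). (\<lambda>v. X v \<omega>) \<in> enters_before_paths e (3 - e)}"
proof -
  have "e \<noteq> 3 - e" using assms(2) by auto
  then show ?thesis using sigma_less_iff_path[of _ e "3 - e"] i by auto
qed

lemma hit_event:
  assumes i: "i \<in> {1..s}" and e: "e \<in> {1, 2}"
  shows "{\<omega>\<in>space (P i). sigma X e \<omega> < sigma X (3 - e) \<omega>} \<in> sets (P i)"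
  using path_event[OF i _ enters_before_paths_event, of 0] by (simp only: hit_event_eq[OF i e] add_0 order_refl)

lemma hit_prob_eq:
  assumes i: "i \<in> {1..s}" and e: "e \<in> {1, 2}"
  shows "hit_prob P X i e = \<P>(\<omega> in P i. (\<lambda>v. X v \<omega>) \<in> enters_before_paths e (3 - e))"
  unfolding hit_prob_def hit_event_eq[OF i e] ..

text \<open>By Fubini's theorem the left-hand side is the integral over \<open>t\<close> of the probability that \<open>t\<close> counts. The
  Markov property at time \<open>t\<close> factors this probability into \<open>killed {1, 2} t i j\<close> and the probability that
  the race restarted from \<open>j\<close> is won by \<open>e\<close>.\<close>

theorem occupation_eq_green:
  assumes i: "i \<in> {1..s}" and e: "e \<in> {1, 2}" and j: "j \<in> {3..s}"
  shows "(\<integral>\<^sup>+\<omega>\<in>{\<omega>. sigma X e \<omega> < sigma X (3 - e) \<omega>}. occupation X e j \<omega> \<partial>P i) =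
    green {1, 2} i j * ennreal (hit_prob P X j e)"
proof -
  interpret Pi: prob_space "P i" using law_prob_space[OF i] .
  interpret pair_sigma_finite lborel "P i" ..
  let ?e' = "3 - e" and ?K = "{1, 2 :: nat}"
  define B where "B = enters_before_paths e ?e'"
  have ne: "e \<noteq> ?e'" and K: "?K = {e, ?e'}" and jK: "j \<notin> {e, ?e'}" and js: "j \<in> {1..s}"
    using e j by auto
  have split: "ereal t \<le> sigma X e \<omega> \<and> sigma X e \<omega> < sigma X ?e' \<omega> \<longleftrightarrow>
      avoids ?K (\<lambda>v. X v \<omega>) t \<and> (\<lambda>v. X (t + v) \<omega>) \<in> B"
    and no_entry: "avoids ?K (\<lambda>v. X v \<omega>) t \<Longrightarrow> ereal t \<le> sigma X e \<omega>"
    if "\<omega> \<in> space F" "0 \<le> t" "X t \<omega> = j" for t \<omega>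
  proof -
    have rc: "right_const (\<lambda>v. X v \<omega>)" "right_const (\<lambda>v. X (t + v) \<omega>)"
      using right_const_path right_const_shifted_path that by auto
    have le: "ereal t \<le> sigma X e \<omega> \<longleftrightarrow> avoids {e} (\<lambda>v. X v \<omega>) t"
      using le_sigma_iff_avoids[where X = X and \<omega> = \<omega>, OF rc(1)] that jK by auto
    then show "ereal t \<le> sigma X e \<omega>" if "avoids ?K (\<lambda>v. X v \<omega>) t"
      using that unfolding K by (simp add: avoids_def)
    show "ereal t \<le> sigma X e \<omega> \<and> sigma X e \<omega> < sigma X ?e' \<omega> \<longleftrightarrow>
      avoids ?K (\<lambda>v. X v \<omega>) t \<and> (\<lambda>v. X (t + v) \<omega>) \<in> B"
      using le enters_before_from[of t "\<lambda>v. X v \<omega>" e ?e'] that jK ne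
      unfolding K B_def sigma_less_iff_path[OF that(1) ne] enters_before_paths_iff[OF rc(1) ne]
        enters_before_paths_iff[OF rc(2) ne] by auto
  qed
  have total': "sigma X e \<omega> < sigma X ?e' \<omega> \<longleftrightarrow> (\<lambda>v. X v \<omega>) \<in> B" if "\<omega> \<in> space F" for \<omega>
    unfolding B_def by (rule sigma_less_iff_path[OF that ne])
  \<comment> \<open>The pairs \<open>(t, \<omega>)\<close> such that \<open>t\<close> counts. Stating the race for the whole path makes the set
      measurable in the product; each section at a fixed \<open>t\<close> is rewritten with the shifted path.\<close>
  define J where "J = {x \<in> alive_at ?K i j. (\<lambda>v. X v (snd x)) \<in> B}"
  have B: "B \<in> sets (cyl {0..})" unfolding B_def by (rule enters_before_paths_event)
  have J: "J \<in> sets (lborel \<Otimes>\<^sub>M P i)"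
  proof -
    have "{\<omega>\<in>space (P i). (\<lambda>v. X v \<omega>) \<in> B} \<in> sets (P i)"
      using path_event[OF i _ B, of 0] by simp
    then have "UNIV \<times> {\<omega>\<in>space (P i). (\<lambda>v. X v \<omega>) \<in> B} \<in> sets ((lborel :: real measure) \<Otimes>\<^sub>M P i)"
      by (intro pair_measureI) auto
    then have "alive_at ?K i j \<inter> (UNIV \<times> {\<omega>\<in>space (P i). (\<lambda>v. X v \<omega>) \<in> B}) \<in> sets (lborel \<Otimes>\<^sub>M P i)"
      using alive_at_measurable[OF i] by (intro sets.Int)
    also have "alive_at ?K i j \<inter> (UNIV \<times> {\<omega>\<in>space (P i). (\<lambda>v. X v \<omega>) \<in> B}) = J"
      by (auto simp: J_def alive_at_def)
    finally show ?thesis .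
  qed
  have "(\<integral>\<^sup>+\<omega>\<in>{\<omega>. sigma X e \<omega> < sigma X ?e' \<omega>}. occupation X e j \<omega> \<partial>P i) =
      (\<integral>\<^sup>+\<omega>. \<integral>\<^sup>+t. indicator J (t, \<omega>) \<partial>lborel \<partial>P i)"
  proof (intro nn_integral_cong)
    fix \<omega> assume "\<omega> \<in> space (P i)"
    then have w: "\<omega> \<in> space F" "\<omega> \<in> space (P i)" using i by auto
    have "indicator {t. X t \<omega> = j} t * indicator {t. 0 \<le> t \<and> ereal t \<le> sigma X e \<omega>} t *
        indicator {\<omega>. sigma X e \<omega> < sigma X ?e' \<omega>} \<omega> = (indicator J (t, \<omega>) :: ennreal)" for t
      using split[OF w(1), of t] no_entry[OF w(1), of t] total'[OF w(1)] w(2)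
      by (auto simp: indicator_def J_def alive_at_def)
    then show "occupation X e j \<omega> * indicator {\<omega>. sigma X e \<omega> < sigma X ?e' \<omega>} \<omega> = (\<integral>\<^sup>+t. indicator J (t, \<omega>) \<partial>lborel)"
      unfolding occupation_def
      by (cases "sigma X e \<omega> < sigma X ?e' \<omega>") (simp_all add: indicator_def)
  qed
  also have "\<dots> = (\<integral>\<^sup>+t. \<integral>\<^sup>+\<omega>. indicator J (t, \<omega>) \<partial>P i \<partial>lborel)"
    using J by (intro Fubini) simp
  also have "\<dots> = (\<integral>\<^sup>+t. ennreal (killed ?K t i j) * indicator {0..} t * ennreal (hit_prob P X j e) \<partial>lborel)"
  proof (intro nn_integral_cong)
    fix t :: real
    show "(\<integral>\<^sup>+\<omega>. indicator J (t, \<omega>) \<partial>P i) =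
        ennreal (killed ?K t i j) * indicator {0..} t * ennreal (hit_prob P X j e)"
    proof (cases "0 \<le> t")
      case True
      define A where "A = {\<omega>\<in>space (P i). avoids ?K (\<lambda>v. X v \<omega>) t \<and> X t \<omega> = j \<and> (\<lambda>v. X (t + v) \<omega>) \<in> B}"
      have A: "A \<in> sets (P i)"
        unfolding A_def using i B True by (intro sets.sets_Collect_conj avoids_event X_event path_event) auto
      have "(\<integral>\<^sup>+\<omega>. indicator J (t, \<omega>) \<partial>P i) = (\<integral>\<^sup>+\<omega>. indicator A \<omega> \<partial>P i)"
        using split[of _ t] no_entry[of _ t] total' True i
        by (intro nn_integral_cong) (auto simp: indicator_def J_def A_def alive_at_def)
      also have "\<dots> = ennreal (measure (P i) A)" using A by (simp add: Pi.emeasure_eq_measure)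
      also have "measure (P i) A = killed ?K t i j * hit_prob P X j e"
        unfolding A_def hit_prob_eq[OF js e] B_def[symmetric] by (rule killed_markov[OF i js True B])
      finally show ?thesis using True killed_nonneg by (simp add: ennreal_mult hit_prob_def)
    next
      case False
      then show ?thesis by (simp add: J_def alive_at_def)
    qed
  qed
  also have "\<dots> = green ?K i j * ennreal (hit_prob P X j e)"
    unfolding green_def using killed_measurable[OF i] by (intro nn_integral_multc) simp
  finally show ?thesis .
qed

end

section \<open>The linear equation\<close>

theorem proposition4:
  fixes s :: nat
    and Q :: "real mat"
    and F :: "'w measure"
    and P :: "nat \<Rightarrow> 'w measure"
    and X :: "real \<Rightarrow> 'w \<Rightarrow> nat"
    and \<epsilon>' j :: nat
  assumes "s \<ge> 2"
    and "markov_chain s Q F P X"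
    and "irreducible_chain s P X"
    and "\<epsilon>' \<in> {1, 2}"
    and "j \<in> {3..s}"
  shows "(\<exists>!u. is_solution s Q P X \<epsilon>' j u) \<and>
    (\<forall>u. is_solution s Q P X \<epsilon>' j u \<longrightarrow>
      (\<forall>i\<in>{1..s}.
        0 \<le> vec_entry u i \<and>
        (vec_entry u i = 0 \<longrightarrow> cond_occupation P X i \<epsilon>' j = 0) \<and>
        (vec_entry u i > 0 \<longrightarrow>
          hit_prob P X i \<epsilon>' > 0 \<and>
          cond_occupation P X i \<epsilon>' j = ennreal (vec_entry u i / hit_prob P X i \<epsilon>'))))"
proof -
  interpret markov_chain s Q F P X by fact
  let ?K = "{1, 2 :: nat}"
  define p where "p i = hit_prob P X i \<epsilon>'" for i
  have p: "0 \<le> p i" for i by (simp add: p_def hit_prob_def)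
  have s3: "3 \<le> s" and js: "j \<in> {1..s}" using assms(5) by auto
  have other: "\<exists>e\<in>?K \<inter> {1..s}. e \<noteq> i" for i
    using s3 by (cases "i = 1") auto
  have fin: "green ?K i k < \<infinity>" if "i \<in> {1..s}" "k \<in> {1..s}" for i k
    by (rule green_finite[OF assms(3) other that])
  define G where "G = mat s s (\<lambda>(a, b). - enn2real (green ?K (Suc a) (Suc b)))"
  have Q0_carrier: "Q0 s Q \<in> carrier_mat s s" and G_carrier: "G \<in> carrier_mat s s"
    by (simp_all add: Q0_def G_def)
  have Q0_rate: "Q0 s Q $$ (a, b) = killed_rate ?K (Suc a) (Suc b)" if "a < s" "b < s" for a b
    using that by (auto simp: Q0_def killed_rate_def numeral_2_eq_2 less_Suc_eq)
  have "Q0 s Q * G = 1\<^sub>m s"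
  proof (rule eq_matI)
    fix a b assume "a < dim_row (1\<^sub>m s :: real mat)" "b < dim_col (1\<^sub>m s :: real mat)"
    then have ab: "a < s" "b < s" by auto
    have "(Q0 s Q * G) $$ (a, b) = (\<Sum>c = 0..<s. Q0 s Q $$ (a, c) * G $$ (c, b))"
      using ab Q0_carrier G_carrier by (simp add: scalar_prod_def)
    also have "\<dots> = - (\<Sum>c = 0..<s. killed_rate ?K (Suc a) (Suc c) * enn2real (green ?K (Suc c) (Suc b)))"
      using ab by (simp add: Q0_rate G_def sum_negf)
    also have "(\<Sum>c = 0..<s. killed_rate ?K (Suc a) (Suc c) * enn2real (green ?K (Suc c) (Suc b))) =
        (\<Sum>k\<in>{1..s}. killed_rate ?K (Suc a) k * enn2real (green ?K k (Suc b)))"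
      by (rule sum.reindex_bij_witness[of _ "\<lambda>k. k - 1" Suc]) auto
    also have "\<dots> = - of_bool (Suc a = Suc b)"
      using ab fin by (intro green_right_inverse) auto
    finally show "(Q0 s Q * G) $$ (a, b) = 1\<^sub>m s $$ (a, b)" using ab by simp
  qed (simp_all add: Q0_def G_def)
  note right = this
  have left: "G * Q0 s Q = 1\<^sub>m s"
    by (rule mat_mult_left_right_inverse[OF Q0_carrier G_carrier right])
  define b where "b = (- p j) \<cdot>\<^sub>v canonical_vec s j"
  have b: "b \<in> carrier_vec s" by (simp add: b_def)
  have sol_iff: "is_solution s Q P X \<epsilon>' j u \<longleftrightarrow> u = G *\<^sub>v b" for u
  proof
    assume "is_solution s Q P X \<epsilon>' j u"
    then have u: "u \<in> carrier_vec s" "Q0 s Q *\<^sub>v u = b" by (auto simp: is_solution_def b_def p_def)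
    have "u = (G * Q0 s Q) *\<^sub>v u" using left u by simp
    also have "\<dots> = G *\<^sub>v b" using u by (simp add: assoc_mult_mat_vec[OF G_carrier Q0_carrier])
    finally show "u = G *\<^sub>v b" .
  next
    assume u: "u = G *\<^sub>v b"
    have "Q0 s Q *\<^sub>v u = (Q0 s Q * G) *\<^sub>v b"
      unfolding u by (rule assoc_mult_mat_vec[OF Q0_carrier G_carrier b, symmetric])
    then show "is_solution s Q P X \<epsilon>' j u"
      using right b G_carrier u unfolding is_solution_def by (simp add: b_def p_def)
  qed
  have entry: "vec_entry (G *\<^sub>v b) i = p j * enn2real (green ?K i j)" if "i \<in> {1..s}" for i
  proof -
    have "(G *\<^sub>v b) $ (i - 1) = (\<Sum>c = 0..<s. G $$ (i - 1, c) * b $ c)"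
      using that b G_carrier by (auto simp: scalar_prod_def)
    also have "\<dots> = (\<Sum>c = 0..<s. if c = j - 1 then G $$ (i - 1, j - 1) * - p j else 0)"
      using js by (intro sum.cong refl) (auto simp: b_def unit_vec_def)
    also have "\<dots> = p j * enn2real (green ?K i j)"
    proof -
      have "i - 1 < s" "j - 1 < s" "Suc (i - 1) = i" "Suc (j - 1) = j" using that js by auto
      then show ?thesis by (simp add: G_def del: One_nat_def)
    qed
    finally show ?thesis .
  qed
  have numer: "(\<integral>\<^sup>+\<omega>\<in>{\<omega>. sigma X \<epsilon>' \<omega> < sigma X (3 - \<epsilon>') \<omega>}. occupation X \<epsilon>' j \<omega> \<partial>P i) =
      ennreal (vec_entry (G *\<^sub>v b) i)" if "i \<in> {1..s}" for i
    using fin[OF that js] p unfolding occupation_eq_green[OF that assms(4,5)] entry[OF that]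
    by (simp add: p_def[symmetric] ennreal_mult mult.commute)
  show ?thesis
  proof (intro conjI allI impI ballI)
    show "\<exists>!u. is_solution s Q P X \<epsilon>' j u" by (simp add: sol_iff)
    fix u i assume "is_solution s Q P X \<epsilon>' j u" and i: "i \<in> {1..s}"
    then have u: "u = G *\<^sub>v b" by (simp add: sol_iff)
    show "0 \<le> vec_entry u i" unfolding u entry[OF i] using p by simp
    show "cond_occupation P X i \<epsilon>' j = 0" if "vec_entry u i = 0"
      using that unfolding cond_occupation_def numer[OF i] u[symmetric] by simp
    assume pos: "vec_entry u i > 0"
    show hit: "hit_prob P X i \<epsilon>' > 0"
    proof (rule ccontr)
      assume "\<not> hit_prob P X i \<epsilon>' > 0"
      then have "hit_prob P X i \<epsilon>' = 0" using p[of i] by (simp add: p_def)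
      then have "AE \<omega> in P i. \<not> sigma X \<epsilon>' \<omega> < sigma X (3 - \<epsilon>') \<omega>"
        using prob_space.prob_eq_0[OF law_prob_space[OF i] hit_event[OF i assms(4)]] AE_space[of "P i"]
        unfolding hit_prob_def by (auto elim!: eventually_elim2)
      then have "(\<integral>\<^sup>+\<omega>\<in>{\<omega>. sigma X \<epsilon>' \<omega> < sigma X (3 - \<epsilon>') \<omega>}. occupation X \<epsilon>' j \<omega> \<partial>P i) =
          (\<integral>\<^sup>+\<omega>. 0 \<partial>P i)"
        by (intro nn_integral_cong_AE) (auto elim!: eventually_mono)
      then show False using pos unfolding numer[OF i] u[symmetric] by simp
    qed
    show "cond_occupation P X i \<epsilon>' j = ennreal (vec_entry u i / hit_prob P X i \<epsilon>')"
      using pos hit unfolding cond_occupation_def numer[OF i] u[symmetric] by (simp add: divide_ennreal)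
  qed
qed

end
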